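(* Let $n\ge 2$, let $(\mathcal A,\mu)$ be an $n$-ary partially associative algebra and $(M,\Delta)$ an $n$-ary totally coassociative coalgebra over $\mathbb{K}$. Then $(\mathrm{Hom}(M,\mathcal A),\star)$ is an $n$-ary partially associative algebra, where $\star$ is the convolution product $$f_1\star f_2\star\cdots\star f_n=\mu\circ\lambda_n(f_1\otimes f_2\otimes\cdots\otimes f_n)\circ\Delta .$$
   Context: $\mathbb{K}$ is a field of characteristic $0$; $Id_q$ is the identity of the $q$-th tensor power; $\mathrm{Hom}$ means $\mathbb{K}$-linear maps. An $n$-ary partially associative algebra is a vector space $\mathcal A$ with a linear map $\mu:\mathcal A^{\otimes n}\to\mathcal A$ such that $\sum_{p=0}^{n-1}(-1)^{p(n-1)}\mu\circ(Id_p\otimes\mu\otimes Id_{n-1-p})=0$. An $n$-ary totally coassociative coalgebra is a vector space $M$ with a linear map $\Delta:M\to M^{\otimes n}$ such that $(Id_p\otimes\Delta\otimes Id_{n-1-p})\circ\Delta=(Id_q\otimes\Delta\otimes Id_{n-1-q})\circ\Delta$ for all $p,q\in\{0,\dots,n-1\}$. For vector spaces $E,F$, $\lambda_n:\mathrm{Hom}(E,F)^{\otimes n}\to\mathrm{Hom}(E^{\otimes n},F^{\otimes n})$ is $\lambda_n(f_1\otimes\cdots\otimes f_n)(x_1\otimes\cdots\otimes x_n)=f_1(x_1)\otimes\cdots\otimes f_n(x_n)$. *)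

theory Defs
  imports "HOL-Algebra.AbelCoset" "Jordan_Normal_Form.Missing_VectorSpace"
begin

section \<open>Spaces of linear maps\<close>

text \<open>The \<open>mult\<close> and \<open>one\<close> fields of a \<open>module\<close> record play no role for vector spaces.
  Linear maps are extensional, so that equality in \<open>Hom\<close> is equality of maps on the domain.\<close>

definition Hom ::
  "('k, 'r) ring_scheme \<Rightarrow> ('k, 'a, 'x) module_scheme \<Rightarrow> ('k, 'b, 'y) module_scheme \<Rightarrow>
   ('k, 'a \<Rightarrow> 'b) module"
  where "Hom K V W =
    \<lparr>carrier = module_hom K V W \<inter> extensional (carrier V),
     mult = undefined, one = undefined,
     zero = (\<lambda>v\<in>carrier V. \<zero>\<^bsub>W\<^esub>),
     add = (\<lambda>f g. \<lambda>v\<in>carrier V. f v \<oplus>\<^bsub>W\<^esub> g v),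
     smult = (\<lambda>c f. \<lambda>v\<in>carrier V. c \<odot>\<^bsub>W\<^esub> f v)\<rparr>"


section \<open>Tensor powers\<close>

definition free_space :: "('k, 'r) ring_scheme \<Rightarrow> 'b set \<Rightarrow> ('k, 'b \<Rightarrow> 'k) module"
  where "free_space K B =
    \<lparr>carrier = {c. range c \<subseteq> carrier K \<and> finite {b. c b \<noteq> \<zero>\<^bsub>K\<^esub>} \<and> {b. c b \<noteq> \<zero>\<^bsub>K\<^esub>} \<subseteq> B},
     mult = undefined, one = undefined,
     zero = (\<lambda>b. \<zero>\<^bsub>K\<^esub>),
     add = (\<lambda>c d b. c b \<oplus>\<^bsub>K\<^esub> d b),
     smult = (\<lambda>a c b. a \<otimes>\<^bsub>K\<^esub> c b)\<rparr>"

definition free_gen :: "('k, 'r) ring_scheme \<Rightarrow> 'b \<Rightarrow> 'b \<Rightarrow> 'k"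
  where "free_gen K b = (\<lambda>x. if x = b then \<one>\<^bsub>K\<^esub> else \<zero>\<^bsub>K\<^esub>)"

definition quotient_space :: "('k, 'b, 'y) module_scheme \<Rightarrow> 'b set \<Rightarrow> ('k, 'b set) module"
  where "quotient_space U N =
    \<lparr>carrier = a_rcosets\<^bsub>U\<^esub> N,
     mult = undefined, one = undefined,
     zero = N,
     add = (\<lambda>X Y. X <+>\<^bsub>U\<^esub> Y),
     smult = (\<lambda>a X. \<Union>u\<in>X. N +>\<^bsub>U\<^esub> (a \<odot>\<^bsub>U\<^esub> u))\<rparr>"

definition tuples :: "('k, 'a, 'x) module_scheme \<Rightarrow> nat \<Rightarrow> 'a list set"
  where "tuples V n = {xs. set xs \<subseteq> carrier V \<and> length xs = n}"

definition tensor_relations ::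
  "('k, 'r) ring_scheme \<Rightarrow> ('k, 'a, 'x) module_scheme \<Rightarrow> nat \<Rightarrow> ('a list \<Rightarrow> 'k) set"
  where "tensor_relations K V n =
    (let F = free_space K (tuples V n) in
      {free_gen K (xs[i := x \<oplus>\<^bsub>V\<^esub> y]) \<ominus>\<^bsub>F\<^esub>
         (free_gen K (xs[i := x]) \<oplus>\<^bsub>F\<^esub> free_gen K (xs[i := y])) | xs i x y.
         xs \<in> tuples V n \<and> i < n \<and> x \<in> carrier V \<and> y \<in> carrier V} \<union>
      {free_gen K (xs[i := a \<odot>\<^bsub>V\<^esub> x]) \<ominus>\<^bsub>F\<^esub> a \<odot>\<^bsub>F\<^esub> free_gen K (xs[i := x]) | xs i a x.
         xs \<in> tuples V n \<and> i < n \<and> a \<in> carrier K \<and> x \<in> carrier V})"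

definition tensor_null ::
  "('k, 'r) ring_scheme \<Rightarrow> ('k, 'a, 'x) module_scheme \<Rightarrow> nat \<Rightarrow> ('a list \<Rightarrow> 'k) set"
  where "tensor_null K V n =
    LinearCombinations.module.span K (free_space K (tuples V n)) (tensor_relations K V n)"

definition tensor_power ::
  "('k, 'r) ring_scheme \<Rightarrow> ('k, 'a, 'x) module_scheme \<Rightarrow> nat \<Rightarrow> ('k, ('a list \<Rightarrow> 'k) set) module"
  where "tensor_power K V n = quotient_space (free_space K (tuples V n)) (tensor_null K V n)"

text \<open>\<open>pure K V [x\<^sub>1, \<dots>, x\<^sub>n]\<close> is the elementary tensor $x_1 \otimes \cdots \otimes x_n$.\<close>

definition pure ::
  "('k, 'r) ring_scheme \<Rightarrow> ('k, 'a, 'x) module_scheme \<Rightarrow> 'a list \<Rightarrow> ('a list \<Rightarrow> 'k) set"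
  where "pure K V xs =
    tensor_null K V (length xs) +>\<^bsub>free_space K (tuples V (length xs))\<^esub> free_gen K xs"

text \<open>The linear map on the \<open>n\<close>-th tensor power with prescribed values on elementary tensors;
  lemma \<open>tensor_lift_ex1\<close> below shows that it exists and is unique whenever \<open>f\<close> is multilinear.\<close>

definition tensor_lift ::
  "('k, 'r) ring_scheme \<Rightarrow> ('k, 'a, 'x) module_scheme \<Rightarrow> nat \<Rightarrow> ('k, 'b, 'y) module_scheme \<Rightarrow>
   ('a list \<Rightarrow> 'b) \<Rightarrow> ('a list \<Rightarrow> 'k) set \<Rightarrow> 'b"
  where "tensor_lift K V n W f =
    (THE h. h \<in> carrier (Hom K (tensor_power K V n) W) \<and>
            (\<forall>xs\<in>tuples V n. h (pure K V xs) = f xs))"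

definition multilinear ::
  "('k, 'r) ring_scheme \<Rightarrow> ('k, 'a, 'x) module_scheme \<Rightarrow> nat \<Rightarrow> ('k, 'b, 'y) module_scheme \<Rightarrow>
   ('a list \<Rightarrow> 'b) \<Rightarrow> bool"
  where "multilinear K V n W f \<longleftrightarrow>
    f \<in> tuples V n \<rightarrow> carrier W \<and>
    (\<forall>xs\<in>tuples V n. \<forall>i<n. (\<lambda>x. f (xs[i := x])) \<in> module_hom K V W)"


section \<open>Existence and uniqueness of linear extensions\<close>

lemma free_space_module:
  fixes K :: "('k, 'r) ring_scheme" and B :: "'b set"
  assumes "cring K"
  shows "module K (free_space K B)"
proof -
  interpret K: cring K by fact
  have fin: "finite {b. c b \<oplus>\<^bsub>K\<^esub> d b \<noteq> \<zero>\<^bsub>K\<^esub>}"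
    if "finite {b. c b \<noteq> \<zero>\<^bsub>K\<^esub>}" "finite {b. d b \<noteq> \<zero>\<^bsub>K\<^esub>}" for c d :: "'b \<Rightarrow> 'k"
    by (rule finite_subset[OF _ finite_UnI[OF that]]) auto
  have fin2: "finite {b. a \<otimes>\<^bsub>K\<^esub> c b \<noteq> \<zero>\<^bsub>K\<^esub>}"
    if "finite {b. c b \<noteq> \<zero>\<^bsub>K\<^esub>}" "a \<in> carrier K" for c :: "'b \<Rightarrow> 'k" and a
    by (rule finite_subset[OF _ that(1)]) (use that in auto)
  have fin3: "finite {b. \<ominus>\<^bsub>K\<^esub> c b \<noteq> \<zero>\<^bsub>K\<^esub>}"
    if "finite {b. c b \<noteq> \<zero>\<^bsub>K\<^esub>}" for c :: "'b \<Rightarrow> 'k"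
    by (rule finite_subset[OF _ that(1)]) auto
  have neg: "\<exists>d\<in>carrier (free_space K B). c \<oplus>\<^bsub>free_space K B\<^esub> d = \<zero>\<^bsub>free_space K B\<^esub>"
    if "c \<in> carrier (free_space K B)" for c
    by (rule bexI[of _ "\<lambda>b. \<ominus>\<^bsub>K\<^esub> c b"])
      (use that in \<open>auto simp: free_space_def image_subset_iff subset_iff fin3 K.r_neg\<close>)
  have mem: "c \<in> carrier (free_space K B) \<longleftrightarrow>
      (\<forall>b. c b \<in> carrier K) \<and> finite {b. c b \<noteq> \<zero>\<^bsub>K\<^esub>} \<and> (\<forall>b. b \<notin> B \<longrightarrow> c b = \<zero>\<^bsub>K\<^esub>)" for c
    by (auto simp: free_space_def)
  have ops: "(c \<oplus>\<^bsub>free_space K B\<^esub> d) = (\<lambda>b. c b \<oplus>\<^bsub>K\<^esub> d b)"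
    "\<zero>\<^bsub>free_space K B\<^esub> = (\<lambda>b. \<zero>\<^bsub>K\<^esub>)"
    "(a \<odot>\<^bsub>free_space K B\<^esub> c) = (\<lambda>b. a \<otimes>\<^bsub>K\<^esub> c b)" for a c d
    by (auto simp: free_space_def)
  show ?thesis
    by (rule module_criteria)
      (use neg in \<open>auto simp: mem ops fin fin2 K.is_cring K.a_ac K.m_assoc K.l_distr K.r_distr\<close>)
qed

lemma free_gen_closed:
  assumes "cring K" "b \<in> B"
  shows "free_gen K b \<in> carrier (free_space K B)"
proof -
  interpret K: cring K by fact
  show ?thesis
    using assms(2) by (auto simp: free_space_def free_gen_def intro: finite_subset[of _ "{b}"])
qed

lemma vs_submodule_abelian_subgroup:
  assumes "LinearCombinations.submodule K N U"
  shows "abelian_subgroup N U"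
proof -
  interpret LinearCombinations.submodule K N U by fact
  interpret U: module K U by (rule module)
  have "additive_subgroup N U"
  proof (rule additive_subgroupI, rule U.add.subgroupI)
    show "\<ominus>\<^bsub>U\<^esub> a \<in> N" if "a \<in> N" for a
    proof -
      have "a \<in> carrier U" using that subset by auto
      hence "\<ominus>\<^bsub>U\<^esub> a = (\<ominus>\<^bsub>K\<^esub> \<one>\<^bsub>K\<^esub>) \<odot>\<^bsub>U\<^esub> a" by (simp add: U.smult_l_minus)
      thus ?thesis using that smult_closed[of "\<ominus>\<^bsub>K\<^esub> \<one>\<^bsub>K\<^esub>" a] by simp
    qed
  next
    show "N \<noteq> {}" using zero_closed by blast
  qed (use subset in auto)
  thus ?thesis by (rule abelian_subgroupI3) (rule U.abelian_group_axioms)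
qed

context
  fixes K :: "('k, 'r) ring_scheme" and U :: "('k, 'b, 'y) module_scheme" and N :: "'b set"
  assumes N: "LinearCombinations.submodule K N U"
begin

interpretation N: LinearCombinations.submodule K N U by (rule N)
interpretation U: module K U by (rule N.module)
interpretation S: abelian_subgroup N U by (rule vs_submodule_abelian_subgroup[OF N])

lemma quotient_carrier: "carrier (quotient_space U N) = (\<lambda>u. N +>\<^bsub>U\<^esub> u) ` carrier U"
  by (auto simp: quotient_space_def A_RCOSETS_def RCOSETS_def a_r_coset_def)

lemma quotient_zero: "\<zero>\<^bsub>quotient_space U N\<^esub> = N +>\<^bsub>U\<^esub> \<zero>\<^bsub>U\<^esub>"
  using S.a_subset by (simp add: quotient_space_def)

lemma quotient_add:
  "u \<in> carrier U \<Longrightarrow> v \<in> carrier U \<Longrightarrow>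
   (N +>\<^bsub>U\<^esub> u) \<oplus>\<^bsub>quotient_space U N\<^esub> (N +>\<^bsub>U\<^esub> v) = N +>\<^bsub>U\<^esub> (u \<oplus>\<^bsub>U\<^esub> v)"
  by (simp add: quotient_space_def S.a_rcos_sum)

lemma coset_eq_iff:
  assumes "u \<in> carrier U" "v \<in> carrier U"
  shows "N +>\<^bsub>U\<^esub> u = N +>\<^bsub>U\<^esub> v \<longleftrightarrow> (\<exists>h\<in>N. u = h \<oplus>\<^bsub>U\<^esub> v)"
proof
  assume "N +>\<^bsub>U\<^esub> u = N +>\<^bsub>U\<^esub> v"
  hence "u \<in> N +>\<^bsub>U\<^esub> v" using S.a_rcos_self[OF assms(1)] by simp
  thus "\<exists>h\<in>N. u = h \<oplus>\<^bsub>U\<^esub> v" by (auto simp: a_r_coset_def r_coset_def)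
next
  assume "\<exists>h\<in>N. u = h \<oplus>\<^bsub>U\<^esub> v"
  hence "u \<in> N +>\<^bsub>U\<^esub> v" by (auto simp: a_r_coset_def r_coset_def)
  thus "N +>\<^bsub>U\<^esub> u = N +>\<^bsub>U\<^esub> v"
    using U.a_repr_independence[OF _ assms(2) S.a_subgroup] by simp
qed

lemma quotient_smult:
  assumes "a \<in> carrier K" "u \<in> carrier U"
  shows "a \<odot>\<^bsub>quotient_space U N\<^esub> (N +>\<^bsub>U\<^esub> u) = N +>\<^bsub>U\<^esub> (a \<odot>\<^bsub>U\<^esub> u)"
proof -
  have "N +>\<^bsub>U\<^esub> (a \<odot>\<^bsub>U\<^esub> v) = N +>\<^bsub>U\<^esub> (a \<odot>\<^bsub>U\<^esub> u)" if "v \<in> N +>\<^bsub>U\<^esub> u" for v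
  proof -
    have "\<exists>h\<in>N. v = h \<oplus>\<^bsub>U\<^esub> u" using that by (auto simp: a_r_coset_def r_coset_def)
    then obtain h where h: "h \<in> N" "v = h \<oplus>\<^bsub>U\<^esub> u" by blast
    hence hU: "h \<in> carrier U" using N.subset by auto
    have "a \<odot>\<^bsub>U\<^esub> v = a \<odot>\<^bsub>U\<^esub> h \<oplus>\<^bsub>U\<^esub> a \<odot>\<^bsub>U\<^esub> u" using h hU assms by (simp add: U.smult_r_distr)
    thus ?thesis using h hU assms by (subst coset_eq_iff) (auto intro: N.smult_closed)
  qed
  moreover have "u \<in> N +>\<^bsub>U\<^esub> u" using assms S.a_rcos_self by simp
  ultimately have "(\<Union>v\<in>N +>\<^bsub>U\<^esub> u. N +>\<^bsub>U\<^esub> (a \<odot>\<^bsub>U\<^esub> v)) = N +>\<^bsub>U\<^esub> (a \<odot>\<^bsub>U\<^esub> u)"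
    by (subst SUP_cong[OF refl]) (assumption, blast)
  thus ?thesis by (simp add: quotient_space_def)
qed

lemma quotient_space_module: "module K (quotient_space U N)"
proof (rule module_criteria)
  show "cring K" ..
  show "\<zero>\<^bsub>quotient_space U N\<^esub> \<in> carrier (quotient_space U N)"
    by (simp add: quotient_carrier quotient_zero)
  show "\<forall>v\<in>carrier (quotient_space U N).
       \<exists>w\<in>carrier (quotient_space U N). v \<oplus>\<^bsub>quotient_space U N\<^esub> w = \<zero>\<^bsub>quotient_space U N\<^esub>"
  proof
    fix X assume "X \<in> carrier (quotient_space U N)"
    then obtain u where u: "u \<in> carrier U" "X = N +>\<^bsub>U\<^esub> u" by (auto simp: quotient_carrier)
    show "\<exists>w\<in>carrier (quotient_space U N). X \<oplus>\<^bsub>quotient_space U N\<^esub> w = \<zero>\<^bsub>quotient_space U N\<^esub>"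
      by (rule bexI[of _ "N +>\<^bsub>U\<^esub> (\<ominus>\<^bsub>U\<^esub> u)"])
        (use u in \<open>auto simp: quotient_carrier quotient_add quotient_zero U.r_neg\<close>)
  qed
qed (auto simp: quotient_carrier quotient_add quotient_smult quotient_zero U.smult_l_distr U.a_ac
        U.smult_r_distr U.smult_assoc1)

lemma quotient_lift:
  assumes W: "module K W" and g: "g \<in> module_hom K U W" and g0: "\<And>u. u \<in> N \<Longrightarrow> g u = \<zero>\<^bsub>W\<^esub>"
  obtains h where "h \<in> module_hom K (quotient_space U N) W"
    "\<And>u. u \<in> carrier U \<Longrightarrow> h (N +>\<^bsub>U\<^esub> u) = g u"
proof -
  interpret W: module K W by (rule W)
  have gc: "g u \<in> carrier W" if "u \<in> carrier U" for u
    using module_hom_closed[OF g] that by auto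
  define h where "h X = (THE w. w \<in> g ` X)" for X
  have h: "h (N +>\<^bsub>U\<^esub> u) = g u" if u: "u \<in> carrier U" for u
    unfolding h_def
  proof (rule the_equality)
    show "g u \<in> g ` (N +>\<^bsub>U\<^esub> u)" using S.a_rcos_self[OF u] by auto
    fix w assume "w \<in> g ` (N +>\<^bsub>U\<^esub> u)"
    then obtain n where "n \<in> N" "w = g (n \<oplus>\<^bsub>U\<^esub> u)" by (auto simp: a_r_coset_def r_coset_def)
    thus "w = g u" using u N.subset gc by (auto simp: module_hom_add[OF g] g0)
  qed
  have "h \<in> module_hom K (quotient_space U N) W"
    unfolding module_hom_def
    by (auto simp: quotient_carrier quotient_add quotient_smult h gc module_hom_add[OF g]
        module_hom_smult[OF g])
  thus ?thesis using h that by blast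
qed

end

lemma free_space_finsum:
  assumes "cring K" "finite I" "\<And>i. i \<in> I \<Longrightarrow> g i \<in> carrier (free_space K B)"
  shows "(\<Oplus>\<^bsub>free_space K B\<^esub> i\<in>I. g i) = (\<lambda>b. \<Oplus>\<^bsub>K\<^esub> i\<in>I. g i b)"
proof -
  interpret K: cring K by fact
  interpret F: module K "free_space K B" by (rule free_space_module) fact
  have *: "g i b \<in> carrier K" if "i \<in> I" for i b
    using assms(3)[OF that] by (auto simp: free_space_def)
  show ?thesis using assms(2,3) *
  proof (induction I rule: finite_induct)
    case empty
    have "\<zero>\<^bsub>free_space K B\<^esub> = (\<lambda>b. \<zero>\<^bsub>K\<^esub>)" by (simp add: free_space_def)
    then show ?case by simp
  next
    case (insert x I)
    have "(\<Oplus>\<^bsub>free_space K B\<^esub> i\<in>insert x I. g i) = g x \<oplus>\<^bsub>free_space K B\<^esub> (\<Oplus>\<^bsub>free_space K B\<^esub> i\<in>I. g i)"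
      by (rule F.finsum_insert) (use insert in auto)
    also have "(\<Oplus>\<^bsub>free_space K B\<^esub> i\<in>I. g i) = (\<lambda>b. \<Oplus>\<^bsub>K\<^esub> i\<in>I. g i b)"
      by (rule insert.IH) (use insert in auto)
    also have "g x \<oplus>\<^bsub>free_space K B\<^esub> (\<lambda>b. \<Oplus>\<^bsub>K\<^esub> i\<in>I. g i b) = (\<lambda>b. g x b \<oplus>\<^bsub>K\<^esub> (\<Oplus>\<^bsub>K\<^esub> i\<in>I. g i b))"
      by (simp add: free_space_def)
    also have "\<dots> = (\<lambda>b. \<Oplus>\<^bsub>K\<^esub> i\<in>insert x I. g i b)"
    proof
      fix b show "g x b \<oplus>\<^bsub>K\<^esub> (\<Oplus>\<^bsub>K\<^esub> i\<in>I. g i b) = (\<Oplus>\<^bsub>K\<^esub> i\<in>insert x I. g i b)"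
        by (rule K.finsum_insert[symmetric]) (use insert in auto)
    qed
    finally show ?case .
  qed
qed

lemma module_hom_finsum:
  assumes "module K V" "module K W" "h \<in> module_hom K V W" "finite I"
    and "\<And>i. i \<in> I \<Longrightarrow> v i \<in> carrier V"
  shows "h (\<Oplus>\<^bsub>V\<^esub> i\<in>I. v i) = (\<Oplus>\<^bsub>W\<^esub> i\<in>I. h (v i))"
proof -
  interpret V: module K V by fact
  interpret W: module K W by fact
  interpret h: mod_hom K V W h using assms by unfold_locales
  show ?thesis using assms(4,5)
  proof (induction I rule: finite_induct)
    case (insert i I)
    hence "v \<in> I \<rightarrow> carrier V" "(\<lambda>i. h (v i)) \<in> I \<rightarrow> carrier W" by auto
    thus ?case using insert by simp
  qed simp
qed

lemma free_space_expand:
  assumes "cring K" "c \<in> carrier (free_space K B)"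
  shows "c = (\<Oplus>\<^bsub>free_space K B\<^esub> b\<in>{b. c b \<noteq> \<zero>\<^bsub>K\<^esub>}. c b \<odot>\<^bsub>free_space K B\<^esub> free_gen K b)"
proof -
  interpret K: cring K by fact
  interpret F: module K "free_space K B" by (rule free_space_module) fact
  let ?S = "{b. c b \<noteq> \<zero>\<^bsub>K\<^esub>}"
  have S: "finite ?S" "?S \<subseteq> B" and cK: "\<And>b. c b \<in> carrier K"
    using assms(2) by (auto simp: free_space_def)
  have gen: "free_gen K b \<in> carrier (free_space K B)" if "b \<in> ?S" for b
    using free_gen_closed[OF assms(1) subsetD[OF S(2) that]] .
  have "(\<Oplus>\<^bsub>free_space K B\<^esub> b\<in>?S. c b \<odot>\<^bsub>free_space K B\<^esub> free_gen K b) =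
    (\<lambda>x. \<Oplus>\<^bsub>K\<^esub> b\<in>?S. (c b \<odot>\<^bsub>free_space K B\<^esub> free_gen K b) x)"
    by (rule free_space_finsum) (use assms S cK gen in auto)
  also have "\<dots> = (\<lambda>x. \<Oplus>\<^bsub>K\<^esub> b\<in>?S. if x = b then c b else \<zero>\<^bsub>K\<^esub>)"
    by (rule ext, rule K.finsum_cong) (use cK in \<open>auto simp: free_space_def free_gen_def simp_implies_def\<close>)
  also have "\<dots> = c"
  proof
    fix x
    show "(\<Oplus>\<^bsub>K\<^esub> b\<in>?S. if x = b then c b else \<zero>\<^bsub>K\<^esub>) = c x"
    proof (cases "x \<in> ?S")
      case True
      thus ?thesis using K.finsum_singleton[OF True S(1), of c] cK by auto
    next
      case False
      hence "(\<Oplus>\<^bsub>K\<^esub> b\<in>?S. if x = b then c b else \<zero>\<^bsub>K\<^esub>) = (\<Oplus>\<^bsub>K\<^esub> b\<in>?S. \<zero>\<^bsub>K\<^esub>)"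
        by (intro K.finsum_cong) (auto simp: simp_implies_def)
      thus ?thesis using False by simp
    qed
  qed
  finally show ?thesis by simp
qed

lemma free_space_lift:
  fixes K :: "('k, 'r) ring_scheme" and B :: "'b set" and W :: "('k, 'c, 'y) module_scheme"
  assumes W: "module K W" and f: "f \<in> B \<rightarrow> carrier W"
  obtains g where "g \<in> module_hom K (free_space K B) W" "\<And>b. b \<in> B \<Longrightarrow> g (free_gen K b) = f b"
proof -
  interpret W: module K W by fact
  have K: "cring K" ..
  define s where "s c = {b. c b \<noteq> \<zero>\<^bsub>K\<^esub>}" for c :: "'b \<Rightarrow> 'k"
  define g where "g c = (\<Oplus>\<^bsub>W\<^esub> b\<in>s c. c b \<odot>\<^bsub>W\<^esub> f b)" for c
  have car: "finite (s c)" "s c \<subseteq> B" "\<And>b. c b \<in> carrier K" if "c \<in> carrier (free_space K B)" for c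
    using that by (auto simp: free_space_def s_def)
  have ext: "g c = (\<Oplus>\<^bsub>W\<^esub> b\<in>T. c b \<odot>\<^bsub>W\<^esub> f b)"
    if "c \<in> carrier (free_space K B)" "finite T" "s c \<subseteq> T" "T \<subseteq> B" for c T
  proof -
    have fT: "f x \<in> carrier W" if "x \<in> T" for x using f \<open>T \<subseteq> B\<close> that by auto
    show ?thesis
      unfolding g_def
      by (rule W.add.finprod_mono_neutral_cong_left)
        (use that car[OF that(1)] fT in \<open>auto simp: s_def\<close>)
  qed
  have 1: "g c \<in> carrier W" if "c \<in> carrier (free_space K B)" for c
    unfolding g_def by (rule W.finsum_closed) (use car[OF that] f in auto)
  interpret F: module K "free_space K B" by (rule free_space_module) fact
  have 2: "g (c \<oplus>\<^bsub>free_space K B\<^esub> d) = g c \<oplus>\<^bsub>W\<^esub> g d"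
    if c: "c \<in> carrier (free_space K B)" and d: "d \<in> carrier (free_space K B)" for c d
  proof -
    let ?T = "s c \<union> s d"
    have cd: "c \<oplus>\<^bsub>free_space K B\<^esub> d \<in> carrier (free_space K B)" using c d by auto
    have e: "(c \<oplus>\<^bsub>free_space K B\<^esub> d) b = c b \<oplus>\<^bsub>K\<^esub> d b" for b by (simp add: free_space_def)
    have T: "finite ?T" "?T \<subseteq> B" using car[OF c] car[OF d] by auto
    have fT: "f b \<in> carrier W" if "b \<in> ?T" for b using f subsetD[OF T(2) that] by auto
    have "g (c \<oplus>\<^bsub>free_space K B\<^esub> d) = (\<Oplus>\<^bsub>W\<^esub> b\<in>?T. (c \<oplus>\<^bsub>free_space K B\<^esub> d) b \<odot>\<^bsub>W\<^esub> f b)"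
      by (rule ext) (use cd T in \<open>auto simp: s_def e\<close>)
    also have "\<dots> = (\<Oplus>\<^bsub>W\<^esub> b\<in>?T. c b \<odot>\<^bsub>W\<^esub> f b \<oplus>\<^bsub>W\<^esub> d b \<odot>\<^bsub>W\<^esub> f b)"
      by (rule W.finsum_cong) (use car(3)[OF c] car(3)[OF d] fT in \<open>auto simp: e W.smult_l_distr simp_implies_def\<close>)
    also have "\<dots> = (\<Oplus>\<^bsub>W\<^esub> b\<in>?T. c b \<odot>\<^bsub>W\<^esub> f b) \<oplus>\<^bsub>W\<^esub> (\<Oplus>\<^bsub>W\<^esub> b\<in>?T. d b \<odot>\<^bsub>W\<^esub> f b)"
      by (rule W.finsum_addf) (use car(3)[OF c] car(3)[OF d] fT in blast)+
    also have "\<dots> = g c \<oplus>\<^bsub>W\<^esub> g d"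
      using ext[OF c T(1) _ T(2)] ext[OF d T(1) _ T(2)] by simp
    finally show ?thesis .
  qed
  have 3: "g (a \<odot>\<^bsub>free_space K B\<^esub> c) = a \<odot>\<^bsub>W\<^esub> g c"
    if c: "c \<in> carrier (free_space K B)" and a: "a \<in> carrier K" for a c
  proof -
    have ac: "a \<odot>\<^bsub>free_space K B\<^esub> c \<in> carrier (free_space K B)" using c a by auto
    have e: "(a \<odot>\<^bsub>free_space K B\<^esub> c) b = a \<otimes>\<^bsub>K\<^esub> c b" for b by (simp add: free_space_def)
    have "g (a \<odot>\<^bsub>free_space K B\<^esub> c) = (\<Oplus>\<^bsub>W\<^esub> b\<in>s c. (a \<odot>\<^bsub>free_space K B\<^esub> c) b \<odot>\<^bsub>W\<^esub> f b)"
      by (rule ext) (use ac car[OF c] a in \<open>auto simp: s_def e\<close>)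
    also have "\<dots> = (\<Oplus>\<^bsub>W\<^esub> b\<in>s c. a \<odot>\<^bsub>W\<^esub> (c b \<odot>\<^bsub>W\<^esub> f b))"
      by (rule W.finsum_cong) (use car[OF c] f a in \<open>auto simp: e W.smult_assoc1 simp_implies_def Pi_def subset_iff\<close>)
    also have "\<dots> = a \<odot>\<^bsub>W\<^esub> g c"
      unfolding g_def by (rule W.finsum_smult_ldistr[symmetric]) (use car[OF c] f a in auto)
    finally show ?thesis .
  qed
  have 4: "g (free_gen K b) = f b" if b: "b \<in> B" for b
  proof -
    have "g (free_gen K b) = (\<Oplus>\<^bsub>W\<^esub> x\<in>{b}. free_gen K b x \<odot>\<^bsub>W\<^esub> f x)"
      by (rule ext) (use b free_gen_closed[OF K b] in \<open>auto simp: s_def free_gen_def split: if_splits\<close>)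
    thus ?thesis using b f by (auto simp: free_gen_def Pi_def)
  qed
  show ?thesis using that[of g] 1 2 3 4 by (auto simp: module_hom_def)
qed

lemma tensor_relations_closed:
  assumes "module K V"
  shows "tensor_relations K V n \<subseteq> carrier (free_space K (tuples V n))"
proof -
  interpret V: module K V by fact
  interpret F: module K "free_space K (tuples V n)" by (rule free_space_module) unfold_locales
  have K: "cring K" ..
  have upd: "xs[i := x] \<in> tuples V n" if "xs \<in> tuples V n" "x \<in> carrier V" for xs i x
    using that set_update_subset_insert[of xs i x] by (auto simp: tuples_def)
  show ?thesis
    unfolding tensor_relations_def Let_def
    by (auto intro!: free_gen_closed[OF K] upd F.minus_closed F.smult_closed F.a_closed)
qed

lemma tensor_null_submodule:
  assumes "module K V"
  shows "LinearCombinations.submodule K (tensor_null K V n) (free_space K (tuples V n))"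
proof -
  interpret V: module K V by fact
  interpret F: module K "free_space K (tuples V n)" by (rule free_space_module) unfold_locales
  show ?thesis
    unfolding tensor_null_def by (rule F.span_is_submodule[OF tensor_relations_closed[OF assms]])
qed

lemma tensor_power_module:
  assumes "module K V"
  shows "module K (tensor_power K V n)"
  unfolding tensor_power_def by (rule quotient_space_module[OF tensor_null_submodule[OF assms]])

lemma pure_closed:
  assumes "module K V" "xs \<in> tuples V n"
  shows "pure K V xs \<in> carrier (tensor_power K V n)"
proof -
  interpret V: module K V by fact
  have K: "cring K" ..
  have "length xs = n" using assms(2) by (simp add: tuples_def)
  thus ?thesis
    using free_gen_closed[OF K assms(2)]
    by (simp add: tensor_power_def pure_def quotient_carrier[OF tensor_null_submodule[OF assms(1)]])
qed

lemma tensor_hom_eqI: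
  assumes V: "module K V" and W: "module K W"
    and h: "h \<in> module_hom K (tensor_power K V n) W" and h': "h' \<in> module_hom K (tensor_power K V n) W"
    and eq: "\<And>xs. xs \<in> tuples V n \<Longrightarrow> h (pure K V xs) = h' (pure K V xs)"
    and t: "t \<in> carrier (tensor_power K V n)"
  shows "h t = h' t"
proof -
  interpret V: module K V by fact
  interpret W: module K W by fact
  have K: "cring K" ..
  let ?F = "free_space K (tuples V n)" and ?N = "tensor_null K V n"
  interpret F: module K ?F by (rule free_space_module[OF K])
  note N = tensor_null_submodule[OF V, of n]
  have pr: "(\<lambda>c. k (?N +>\<^bsub>?F\<^esub> c)) \<in> module_hom K ?F W"
    if "k \<in> module_hom K (tensor_power K V n) W" for k
    using that unfolding module_hom_def tensor_power_def
    by (auto simp: quotient_carrier[OF N] Pi_def simp flip: quotient_add[OF N] quotient_smult[OF N])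
  obtain c where c: "c \<in> carrier ?F" "t = ?N +>\<^bsub>?F\<^esub> c"
    using t by (auto simp: tensor_power_def quotient_carrier[OF N])
  let ?S = "{b. c b \<noteq> \<zero>\<^bsub>K\<^esub>}"
  have S: "finite ?S" "?S \<subseteq> tuples V n" "\<And>b. c b \<in> carrier K"
    using c(1) by (auto simp: free_space_def)
  have gen: "free_gen K b \<in> carrier ?F" if "b \<in> ?S" for b
    using free_gen_closed[OF K subsetD[OF S(2) that]] .
  have expand: "k t = (\<Oplus>\<^bsub>W\<^esub> b\<in>?S. c b \<odot>\<^bsub>W\<^esub> k (pure K V b))"
    if k: "k \<in> module_hom K (tensor_power K V n) W" for k
  proof -
    let ?k = "\<lambda>c. k (?N +>\<^bsub>?F\<^esub> c)"
    have "k t = ?k (\<Oplus>\<^bsub>?F\<^esub> b\<in>?S. c b \<odot>\<^bsub>?F\<^esub> free_gen K b)"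
      using free_space_expand[OF K c(1)] c(2) by simp
    also have "\<dots> = (\<Oplus>\<^bsub>W\<^esub> b\<in>?S. ?k (c b \<odot>\<^bsub>?F\<^esub> free_gen K b))"
      by (rule module_hom_finsum[OF F.module_axioms W pr[OF k]]) (use S gen in auto)
    also have "\<dots> = (\<Oplus>\<^bsub>W\<^esub> b\<in>?S. c b \<odot>\<^bsub>W\<^esub> k (pure K V b))"
    proof (rule W.finsum_cong'[OF refl])
      show "(\<lambda>b. c b \<odot>\<^bsub>W\<^esub> k (pure K V b)) \<in> ?S \<rightarrow> carrier W"
        using S pure_closed[OF V, of _ n] funcset_mem[OF module_hom_closed[OF k]] by auto
      fix b assume "b \<in> ?S"
      hence b: "b \<in> tuples V n" using S(2) by blast
      have "?k (c b \<odot>\<^bsub>?F\<^esub> free_gen K b) = c b \<odot>\<^bsub>W\<^esub> ?k (free_gen K b)"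
        by (rule module_hom_smult[OF pr[OF k] S(3) free_gen_closed[OF K b]])
      moreover have "pure K V b = ?N +>\<^bsub>?F\<^esub> free_gen K b" using b by (simp add: pure_def tuples_def)
      ultimately show "?k (c b \<odot>\<^bsub>?F\<^esub> free_gen K b) = c b \<odot>\<^bsub>W\<^esub> k (pure K V b)" by simp
    qed
    finally show ?thesis .
  qed
  have "(\<Oplus>\<^bsub>W\<^esub> b\<in>?S. c b \<odot>\<^bsub>W\<^esub> h (pure K V b)) = (\<Oplus>\<^bsub>W\<^esub> b\<in>?S. c b \<odot>\<^bsub>W\<^esub> h' (pure K V b))"
    by (rule W.finsum_cong)
      (use S eq pure_closed[OF V] module_hom_closed[OF h'] in \<open>auto simp: simp_implies_def Pi_def subset_iff\<close>)
  thus ?thesis using expand[OF h] expand[OF h'] by simp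
qed

lemma tensor_lift_ex1:
  assumes V: "module K V" and W: "module K W" and f: "multilinear K V n W f"
  shows "\<exists>!h. h \<in> carrier (Hom K (tensor_power K V n) W) \<and>
              (\<forall>xs\<in>tuples V n. h (pure K V xs) = f xs)"
proof -
  interpret V: module K V by fact
  interpret W: module K W by fact
  have K: "cring K" ..
  let ?F = "free_space K (tuples V n)" and ?N = "tensor_null K V n" and ?T = "tensor_power K V n"
  interpret F: module K ?F by (rule free_space_module[OF K])
  interpret T: module K ?T by (rule tensor_power_module[OF V])
  have fc: "f \<in> tuples V n \<rightarrow> carrier W"
    and fi: "\<And>xs i. xs \<in> tuples V n \<Longrightarrow> i < n \<Longrightarrow> (\<lambda>x. f (xs[i := x])) \<in> module_hom K V W"
    using f by (auto simp: multilinear_def)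
  obtain g where g: "g \<in> module_hom K ?F W" and gf: "\<And>xs. xs \<in> tuples V n \<Longrightarrow> g (free_gen K xs) = f xs"
    using free_space_lift[OF W fc] by blast
  interpret g: mod_hom K ?F W g using g by unfold_locales
  have upd: "xs[i := x] \<in> tuples V n" if "xs \<in> tuples V n" "x \<in> carrier V" for xs i x
    using that set_update_subset_insert[of xs i x] by (auto simp: tuples_def)
  have "tensor_relations K V n \<subseteq> g.ker"
  proof
    fix r assume r: "r \<in> tensor_relations K V n"
    hence rc: "r \<in> carrier ?F" using tensor_relations_closed[OF V] by auto
    from r consider (add) xs i x y where "xs \<in> tuples V n" "i < n" "x \<in> carrier V" "y \<in> carrier V"
        "r = free_gen K (xs[i := x \<oplus>\<^bsub>V\<^esub> y]) \<ominus>\<^bsub>?F\<^esub>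
         (free_gen K (xs[i := x]) \<oplus>\<^bsub>?F\<^esub> free_gen K (xs[i := y]))"
      | (smult) xs i a x where "xs \<in> tuples V n" "i < n" "a \<in> carrier K" "x \<in> carrier V"
        "r = free_gen K (xs[i := a \<odot>\<^bsub>V\<^esub> x]) \<ominus>\<^bsub>?F\<^esub> a \<odot>\<^bsub>?F\<^esub> free_gen K (xs[i := x])"
      unfolding tensor_relations_def Let_def by blast
    hence "g r = \<zero>\<^bsub>W\<^esub>"
    proof cases
      case add
      note c = upd[OF add(1) add(3)] upd[OF add(1) add(4)] upd[OF add(1) V.a_closed[OF add(3,4)]]
      show ?thesis
        using c add(3,4) free_gen_closed[OF K c(1)] free_gen_closed[OF K c(2)] free_gen_closed[OF K c(3)]
          module_hom_add[OF fi[OF add(1,2)] add(3,4)] funcset_mem[OF fc]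
        by (simp add: add(5) gf a_minus_def W.r_neg)
    next
      case smult
      note c = upd[OF smult(1) smult(4)] upd[OF smult(1) V.smult_closed[OF smult(3,4)]]
      show ?thesis
        using c smult(3,4) free_gen_closed[OF K c(1)] free_gen_closed[OF K c(2)]
          module_hom_smult[OF fi[OF smult(1,2)] smult(3,4)] funcset_mem[OF fc]
        by (simp add: smult(5) gf a_minus_def W.r_neg)
    qed
    thus "r \<in> g.ker" using rc by (simp add: g.ker_def)
  qed
  hence "?N \<subseteq> g.ker"
    unfolding tensor_null_def by (rule F.span_is_subset[OF _ g.ker_is_submodule])
  hence "g u = \<zero>\<^bsub>W\<^esub>" if "u \<in> ?N" for u using that by (auto simp: g.ker_def)
  then obtain h where h: "h \<in> module_hom K ?T W"
    and hg: "\<And>u. u \<in> carrier ?F \<Longrightarrow> h (?N +>\<^bsub>?F\<^esub> u) = g u"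
    using quotient_lift[OF tensor_null_submodule[OF V, of n] W g] unfolding tensor_power_def by blast
  have hf: "h (pure K V xs) = f xs" if "xs \<in> tuples V n" for xs
    using hg[OF free_gen_closed[OF K that]] gf[OF that] that by (simp add: pure_def tuples_def)
  show ?thesis
  proof (rule ex1I[of _ "restrict h (carrier ?T)"], safe)
    show "restrict h (carrier ?T) \<in> carrier (Hom K ?T W)"
      using h by (auto simp: Hom_def module_hom_def)
    show "restrict h (carrier ?T) (pure K V xs) = f xs" if "xs \<in> tuples V n" for xs
      using that by (simp add: pure_closed[OF V that] hf)
    fix k assume k: "k \<in> carrier (Hom K ?T W)" and kf: "\<forall>xs\<in>tuples V n. k (pure K V xs) = f xs"
    have "k t = h t" if "t \<in> carrier ?T" for t
      by (rule tensor_hom_eqI[OF V W _ h _ that]) (use k kf hf in \<open>auto simp: Hom_def\<close>)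
    moreover have "k \<in> extensional (carrier ?T)" using k by (simp add: Hom_def)
    ultimately show "k = restrict h (carrier ?T)"
      by (auto simp: extensional_def fun_eq_iff)
  qed
qed


section \<open>Maps between tensor powers\<close>

text \<open>$Id_p \otimes \mu \otimes Id_q$ as a map $V^{\otimes(p+n+q)} \to V^{\otimes(p+1+q)}$,
  for linear $\mu : V^{\otimes n} \to V$.\<close>

definition id_mult_id ::
  "('k, 'r) ring_scheme \<Rightarrow> ('k, 'a, 'x) module_scheme \<Rightarrow> nat \<Rightarrow> (('a list \<Rightarrow> 'k) set \<Rightarrow> 'a) \<Rightarrow>
   nat \<Rightarrow> nat \<Rightarrow> ('a list \<Rightarrow> 'k) set \<Rightarrow> ('a list \<Rightarrow> 'k) set"
  where "id_mult_id K V n \<mu> p q =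
    tensor_lift K V (p + n + q) (tensor_power K V (p + 1 + q))
      (\<lambda>xs. pure K V (take p xs @ [\<mu> (pure K V (take n (drop p xs)))] @ drop (p + n) xs))"

text \<open>\<open>tensor_insert K V xs n zs\<close> is the map
  $t \mapsto x_1 \otimes \cdots \otimes x_p \otimes t \otimes z_1 \otimes \cdots \otimes z_q$
  on the \<open>n\<close>-th tensor power.\<close>

definition tensor_insert ::
  "('k, 'r) ring_scheme \<Rightarrow> ('k, 'a, 'x) module_scheme \<Rightarrow> 'a list \<Rightarrow> nat \<Rightarrow> 'a list \<Rightarrow>
   ('a list \<Rightarrow> 'k) set \<Rightarrow> ('a list \<Rightarrow> 'k) set"
  where "tensor_insert K V xs n zs =
    tensor_lift K V n (tensor_power K V (length xs + n + length zs))
      (\<lambda>ys. pure K V (xs @ ys @ zs))"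

text \<open>$Id_p \otimes \Delta \otimes Id_q$ as a map $V^{\otimes(p+1+q)} \to V^{\otimes(p+n+q)}$,
  for linear $\Delta : V \to V^{\otimes n}$.\<close>

definition id_comult_id ::
  "('k, 'r) ring_scheme \<Rightarrow> ('k, 'a, 'x) module_scheme \<Rightarrow> nat \<Rightarrow> ('a \<Rightarrow> ('a list \<Rightarrow> 'k) set) \<Rightarrow>
   nat \<Rightarrow> nat \<Rightarrow> ('a list \<Rightarrow> 'k) set \<Rightarrow> ('a list \<Rightarrow> 'k) set"
  where "id_comult_id K V n \<Delta> p q =
    tensor_lift K V (p + 1 + q) (tensor_power K V (p + n + q))
      (\<lambda>xs. tensor_insert K V (take p xs) n (drop (p + 1) xs) (\<Delta> (xs ! p)))"

definition hom_tensor ::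
  "('k, 'r) ring_scheme \<Rightarrow> ('k, 'a, 'x) module_scheme \<Rightarrow> ('k, 'b, 'y) module_scheme \<Rightarrow> nat \<Rightarrow>
   (('a \<Rightarrow> 'b) list \<Rightarrow> 'k) set \<Rightarrow> ('a list \<Rightarrow> 'k) set \<Rightarrow> ('b list \<Rightarrow> 'k) set"
  where "hom_tensor K E F n =
    tensor_lift K (Hom K E F) n (Hom K (tensor_power K E n) (tensor_power K F n))
      (\<lambda>fs. tensor_lift K E n (tensor_power K F n)
        (\<lambda>xs. pure K F (map2 (\<lambda>f x. f x) fs xs)))"


section \<open>Partially associative algebras and totally coassociative coalgebras\<close>

locale partially_associative_algebra = vectorspace K A
  for K :: "('k, 'r) ring_scheme" and A :: "('k, 'a, 'x) module_scheme" +
  fixes n :: nat and \<mu> :: "('a list \<Rightarrow> 'k) set \<Rightarrow> 'a"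
  assumes mult_linear: "\<mu> \<in> carrier (Hom K (tensor_power K A n) A)"
    and partial_assoc:
      "(\<Oplus>\<^bsub>Hom K (tensor_power K A (2 * n - 1)) A\<^esub> p\<in>{0..<n}.
          ((\<ominus>\<^bsub>K\<^esub> \<one>\<^bsub>K\<^esub>) [^]\<^bsub>K\<^esub> (p * (n - 1))) \<odot>\<^bsub>Hom K (tensor_power K A (2 * n - 1)) A\<^esub>
          compose (carrier (tensor_power K A (2 * n - 1))) \<mu> (id_mult_id K A n \<mu> p (n - 1 - p)))
       = \<zero>\<^bsub>Hom K (tensor_power K A (2 * n - 1)) A\<^esub>"

locale totally_coassociative_coalgebra = vectorspace K M
  for K :: "('k, 'r) ring_scheme" and M :: "('k, 'm, 'x) module_scheme" +
  fixes n :: nat and \<Delta> :: "'m \<Rightarrow> ('m list \<Rightarrow> 'k) set"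
  assumes comult_linear: "\<Delta> \<in> carrier (Hom K M (tensor_power K M n))"
    and total_coassoc:
      "\<And>p q. \<lbrakk>p < n; q < n\<rbrakk> \<Longrightarrow>
        compose (carrier M) (id_comult_id K M n \<Delta> p (n - 1 - p)) \<Delta> =
        compose (carrier M) (id_comult_id K M n \<Delta> q (n - 1 - q)) \<Delta>"

definition convolution ::
  "('k, 'r) ring_scheme \<Rightarrow> ('k, 'm, 'x) module_scheme \<Rightarrow> ('k, 'a, 'y) module_scheme \<Rightarrow> nat \<Rightarrow>
   ('m \<Rightarrow> ('m list \<Rightarrow> 'k) set) \<Rightarrow> (('a list \<Rightarrow> 'k) set \<Rightarrow> 'a) \<Rightarrow>
   (('m \<Rightarrow> 'a) list \<Rightarrow> 'k) set \<Rightarrow> 'm \<Rightarrow> 'a"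
  where "convolution K M A n \<Delta> \<mu> =
    (\<lambda>t\<in>carrier (tensor_power K (Hom K M A) n).
       compose (carrier M) \<mu> (compose (carrier M) (hom_tensor K M A n t) \<Delta>))"

end

theory Submission
  imports Defs
begin

text \<open>With $g = g_1 \star \cdots \star g_n$, comparing both sides
  on elementary tensors gives
  $\lambda_n(f_1 \otimes \cdots \otimes f_p \otimes g \otimes h_1 \otimes \cdots \otimes h_q) =
   (Id_p \otimes \mu \otimes Id_q) \circ
   \lambda_{2n-1}(f_1 \otimes \cdots \otimes f_p \otimes g_1 \otimes \cdots \otimes g_n \otimes h_1
     \otimes \cdots \otimes h_q) \circ (Id_p \otimes \Delta \otimes Id_q)$.
  By total coassociativity $w = (Id_p \otimes \Delta \otimes Id_q)(\Delta v)$ does not depend on \<open>p\<close>, so at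
  \<open>v \<in> M\<close> the partial associativity sum of $\star$ is that of $\mu$ evaluated at the single tensor
  $\lambda_{2n-1}(\cdots)(w)$.\<close>

section \<open>Linear maps\<close>

lemma module_homI:
  assumes "\<And>x. x \<in> carrier V \<Longrightarrow> f x \<in> carrier W"
    and "\<And>x y. \<lbrakk>x \<in> carrier V; y \<in> carrier V\<rbrakk> \<Longrightarrow> f (x \<oplus>\<^bsub>V\<^esub> y) = f x \<oplus>\<^bsub>W\<^esub> f y"
    and "\<And>a x. \<lbrakk>a \<in> carrier K; x \<in> carrier V\<rbrakk> \<Longrightarrow> f (a \<odot>\<^bsub>V\<^esub> x) = a \<odot>\<^bsub>W\<^esub> f x"
  shows "f \<in> module_hom K V W"
  using assms by (auto simp: module_hom_def)

lemma module_hom_in_carrier: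
  "\<lbrakk>f \<in> module_hom K V W; x \<in> carrier V\<rbrakk> \<Longrightarrow> f x \<in> carrier W"
  using module_hom_closed by blast

lemma module_hom_comp:
  "\<lbrakk>f \<in> module_hom K U V; g \<in> module_hom K V W\<rbrakk> \<Longrightarrow> (\<lambda>x. g (f x)) \<in> module_hom K U W"
  by (rule module_homI) (simp_all add: module_hom_in_carrier module_hom_add module_hom_smult)

lemma Hom_carrier: "carrier (Hom K V W) = module_hom K V W \<inter> extensional (carrier V)"
  by (simp add: Hom_def)

lemma Hom_module_hom: "f \<in> carrier (Hom K V W) \<Longrightarrow> f \<in> module_hom K V W"
  by (simp add: Hom_carrier)

lemma Hom_in_carrier: "\<lbrakk>f \<in> carrier (Hom K V W); x \<in> carrier V\<rbrakk> \<Longrightarrow> f x \<in> carrier W"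
  by (rule module_hom_in_carrier[OF Hom_module_hom])

lemma Hom_apply:
  assumes "v \<in> carrier V"
  shows "(f \<oplus>\<^bsub>Hom K V W\<^esub> g) v = f v \<oplus>\<^bsub>W\<^esub> g v"
    and "(a \<odot>\<^bsub>Hom K V W\<^esub> f) v = a \<odot>\<^bsub>W\<^esub> f v"
    and "\<zero>\<^bsub>Hom K V W\<^esub> v = \<zero>\<^bsub>W\<^esub>"
  using assms by (simp_all add: Hom_def)

lemma Hom_eqI:
  assumes "f \<in> carrier (Hom K V W)" "g \<in> carrier (Hom K V W)"
    and "\<And>v. v \<in> carrier V \<Longrightarrow> f v = g v"
  shows "f = g"
  by (rule extensionalityI[of _ "carrier V"]) (use assms in \<open>simp_all add: Hom_carrier\<close>)

text \<open>The carrier of \<open>Hom\<close> consists of extensional maps, so a linear map given by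
  a formula enters it only after restriction; linearity survives because the module operations stay
  inside the carrier.\<close>

lemma restrict_Hom:
  assumes U: "module K U" and f: "f \<in> module_hom K U V"
  shows "restrict f (carrier U) \<in> carrier (Hom K U V)"
proof -
  interpret U: module K U by fact
  have "restrict f (carrier U) \<in> module_hom K U V"
    by (rule module_homI) (simp_all add: module_hom_in_carrier[OF f] module_hom_add[OF f]
        module_hom_smult[OF f])
  thus ?thesis by (simp add: Hom_carrier)
qed

lemma compose_Hom:
  assumes "module K U" "f \<in> module_hom K U V" "g \<in> module_hom K V W"
  shows "compose (carrier U) g f \<in> carrier (Hom K U W)"
  unfolding compose_def by (rule restrict_Hom[OF assms(1) module_hom_comp[OF assms(2,3)]])

lemma Hom_module:
  fixes K :: "('k, 'r) ring_scheme" and V :: "('k, 'a, 'x) module_scheme"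
    and W :: "('k, 'b, 'y) module_scheme"
  assumes V: "module K V" and W: "module K W"
  shows "module K (Hom K V W)"
proof -
  interpret V: module K V by fact
  interpret W: module K W by fact
  let ?H = "Hom K V W"
  have K: "cring K" ..
  have zero: "\<zero>\<^bsub>?H\<^esub> \<in> carrier ?H"
    using restrict_Hom[OF V, of "\<lambda>_. \<zero>\<^bsub>W\<^esub>" W] by (simp add: Hom_def module_hom_def)
  have add: "f \<oplus>\<^bsub>?H\<^esub> g \<in> carrier ?H" if "f \<in> carrier ?H" "g \<in> carrier ?H" for f g
  proof -
    note f = Hom_module_hom[OF that(1)] and g = Hom_module_hom[OF that(2)]
    note fc = module_hom_in_carrier[OF f] and gc = module_hom_in_carrier[OF g]
    have "(\<lambda>v. f v \<oplus>\<^bsub>W\<^esub> g v) \<in> module_hom K V W"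
      by (rule module_homI)
        (simp_all add: fc gc module_hom_add[OF f] module_hom_add[OF g] module_hom_smult[OF f]
          module_hom_smult[OF g] W.smult_r_distr W.a_ac)
    from restrict_Hom[OF V this] show ?thesis by (simp add: Hom_def)
  qed
  have smult: "a \<odot>\<^bsub>?H\<^esub> f \<in> carrier ?H" if "a \<in> carrier K" "f \<in> carrier ?H" for a f
  proof -
    note f = Hom_module_hom[OF that(2)]
    note fc = module_hom_in_carrier[OF f]
    have "(\<lambda>v. a \<odot>\<^bsub>W\<^esub> f v) \<in> module_hom K V W"
      by (rule module_homI)
        (simp_all add: that(1) fc module_hom_add[OF f] module_hom_smult[OF f] W.smult_r_distr
          V.m_comm flip: W.smult_assoc1)
    from restrict_Hom[OF V this] show ?thesis by (simp add: Hom_def)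
  qed
  note c = zero add smult Hom_in_carrier[of _ K V W]
  \<comment> \<open>\<open>module_criteria\<close> demands an additive inverse; the scalar multiple
    by -1 supplies it, so that its membership in the carrier already follows from
    \<open>smult\<close>.\<close>
  have neg: "f \<oplus>\<^bsub>?H\<^esub> ((\<ominus>\<^bsub>K\<^esub> \<one>\<^bsub>K\<^esub>) \<odot>\<^bsub>?H\<^esub> f) = \<zero>\<^bsub>?H\<^esub>" if "f \<in> carrier ?H" for f
    by (rule Hom_eqI[of _ K V W]) (use that in \<open>simp_all add: c Hom_apply W.smult_l_minus W.r_neg\<close>)
  show ?thesis
  proof (rule module_criteria[OF K zero], safe)
    show "\<exists>g\<in>carrier ?H. f \<oplus>\<^bsub>?H\<^esub> g = \<zero>\<^bsub>?H\<^esub>" if "f \<in> carrier ?H" for f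
      using neg[OF that] smult[OF _ that] by (meson V.R.add.inv_closed V.R.one_closed)
  qed (auto intro!: Hom_eqI[of _ K V W] simp: c Hom_apply W.a_ac W.smult_assoc1 W.smult_l_distr
      W.smult_r_distr)
qed

lemma Hom_eval: "v \<in> carrier V \<Longrightarrow> (\<lambda>f. f v) \<in> module_hom K (Hom K V W) W"
  by (rule module_homI) (simp_all add: Hom_apply Hom_in_carrier)

text \<open>Evaluation at \<open>v\<close> is linear by \<open>Hom_eval\<close>, hence passes
  through finite sums. The final argument uses this both to evaluate sums of maps and, read
  backwards, to reassemble a sum of values into one map.\<close>

lemma Hom_lincomb_apply:
  assumes V: "module K V" and W: "module K W" and "finite I"
    and f: "\<And>i. i \<in> I \<Longrightarrow> f i \<in> carrier (Hom K V W)" and a: "\<And>i. i \<in> I \<Longrightarrow> a i \<in> carrier K"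
    and v: "v \<in> carrier V"
  shows "(\<Oplus>\<^bsub>Hom K V W\<^esub> i\<in>I. a i \<odot>\<^bsub>Hom K V W\<^esub> f i) v = (\<Oplus>\<^bsub>W\<^esub> i\<in>I. a i \<odot>\<^bsub>W\<^esub> f i v)"
proof -
  interpret H: module K "Hom K V W" by (rule Hom_module[OF V W])
  show ?thesis
    using module_hom_finsum[OF H.module_axioms W Hom_eval[OF v] \<open>finite I\<close>,
        of "\<lambda>i. a i \<odot>\<^bsub>Hom K V W\<^esub> f i"] f a
    by (simp add: Hom_apply[OF v])
qed

text \<open>The operations of \<open>Hom\<close> are pointwise and its elements extensional, so both
  linearity laws can be checked at one argument \<open>v\<close> at a time.\<close>

lemma module_hom_into_Hom:
  assumes V: "module K V" and W: "module K W"
    and c: "\<And>u. u \<in> carrier U \<Longrightarrow> F u \<in> carrier (Hom K V W)"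
    and U: "module K U"
    and eval: "\<And>v. v \<in> carrier V \<Longrightarrow> (\<lambda>u. F u v) \<in> module_hom K U W"
  shows "F \<in> module_hom K U (Hom K V W)"
proof -
  interpret U: module K U by fact
  interpret H: module K "Hom K V W" by (rule Hom_module[OF V W])
  show ?thesis
    by (rule module_homI; (rule Hom_eqI[of _ K V W])?)
      (simp_all add: c Hom_apply module_hom_add[OF eval] module_hom_smult[OF eval])
qed


section \<open>Multilinear maps and tensor powers\<close>

lemma tuples_length: "xs \<in> tuples V n \<Longrightarrow> length xs = n"
  by (simp add: tuples_def)

lemma tuples_nth: "\<lbrakk>xs \<in> tuples V n; i < n\<rbrakk> \<Longrightarrow> xs ! i \<in> carrier V"
  by (auto simp: tuples_def)

lemma tuples_update: "\<lbrakk>xs \<in> tuples V n; x \<in> carrier V\<rbrakk> \<Longrightarrow> xs[i := x] \<in> tuples V n"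
  using set_update_subset_insert[of xs i x] by (auto simp: tuples_def)

lemma tuples_append: "\<lbrakk>xs \<in> tuples V m; ys \<in> tuples V n\<rbrakk> \<Longrightarrow> xs @ ys \<in> tuples V (m + n)"
  by (auto simp: tuples_def)

lemma tuples_singleton: "x \<in> carrier V \<Longrightarrow> [x] \<in> tuples V 1"
  by (simp add: tuples_def)

lemma tuples_take: "\<lbrakk>xs \<in> tuples V n; m \<le> n\<rbrakk> \<Longrightarrow> take m xs \<in> tuples V m"
  using set_take_subset[of m xs] by (auto simp: tuples_def)

lemma tuples_drop: "\<lbrakk>xs \<in> tuples V n; n = m + k\<rbrakk> \<Longrightarrow> drop m xs \<in> tuples V k"
  using set_drop_subset[of m xs] by (auto simp: tuples_def)

text \<open>The generators of \<open>tensor_null\<close> are exactly the defects of additivity and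
  homogeneity in a single slot, and they vanish in the quotient.\<close>

lemma pure_update:
  assumes V: "module K V" and xs: "xs \<in> tuples V n" and i: "i < n"
  shows "(\<lambda>x. pure K V (xs[i := x])) \<in> module_hom K V (tensor_power K V n)"
proof -
  interpret V: module K V by fact
  have K: "cring K" ..
  let ?F = "free_space K (tuples V n)" and ?N = "tensor_null K V n"
  interpret F: module K ?F by (rule free_space_module[OF K])
  note N = tensor_null_submodule[OF V, of n]
  let ?g = "\<lambda>x. free_gen K (xs[i := x])"
  have g: "?g x \<in> carrier ?F" if "x \<in> carrier V" for x
    by (rule free_gen_closed[OF K tuples_update[OF xs that]])
  have pure: "pure K V (xs[i := x]) = ?N +>\<^bsub>?F\<^esub> ?g x" for x
    using xs by (simp add: pure_def tuples_length)
  \<comment> \<open>Two elements of the free space whose difference is a relation have the same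
    coset, since relations lie in their own span.\<close>
  have rel: "?N +>\<^bsub>?F\<^esub> u = ?N +>\<^bsub>?F\<^esub> v"
    if "u \<ominus>\<^bsub>?F\<^esub> v \<in> tensor_relations K V n" "u \<in> carrier ?F" "v \<in> carrier ?F" for u v
  proof -
    have "u \<ominus>\<^bsub>?F\<^esub> v \<in> ?N"
      using F.in_own_span[OF tensor_relations_closed[OF V]] that(1) unfolding tensor_null_def by blast
    moreover have "u = (u \<ominus>\<^bsub>?F\<^esub> v) \<oplus>\<^bsub>?F\<^esub> v"
      using that by (simp add: a_minus_def F.a_assoc F.l_neg)
    ultimately show ?thesis using that by (subst coset_eq_iff[OF N]) auto
  qed
  show ?thesis
  proof (rule module_homI)
    show "pure K V (xs[i := x]) \<in> carrier (tensor_power K V n)" if "x \<in> carrier V" for x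
      by (rule pure_closed[OF V tuples_update[OF xs that]])
    show "pure K V (xs[i := x \<oplus>\<^bsub>V\<^esub> y]) =
        pure K V (xs[i := x]) \<oplus>\<^bsub>tensor_power K V n\<^esub> pure K V (xs[i := y])"
      if "x \<in> carrier V" "y \<in> carrier V" for x y
    proof -
      have "?g (x \<oplus>\<^bsub>V\<^esub> y) \<ominus>\<^bsub>?F\<^esub> (?g x \<oplus>\<^bsub>?F\<^esub> ?g y) \<in> tensor_relations K V n"
        unfolding tensor_relations_def Let_def using xs i that by blast
      from rel[OF this] show ?thesis
        using that by (simp add: pure tensor_power_def quotient_add[OF N] g)
    qed
    show "pure K V (xs[i := a \<odot>\<^bsub>V\<^esub> x]) = a \<odot>\<^bsub>tensor_power K V n\<^esub> pure K V (xs[i := x])"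
      if "a \<in> carrier K" "x \<in> carrier V" for a x
    proof -
      have "?g (a \<odot>\<^bsub>V\<^esub> x) \<ominus>\<^bsub>?F\<^esub> (a \<odot>\<^bsub>?F\<^esub> ?g x) \<in> tensor_relations K V n"
        unfolding tensor_relations_def Let_def using xs i that by blast
      from rel[OF this] show ?thesis
        using that by (simp add: pure tensor_power_def quotient_smult[OF N] g)
    qed
  qed
qed

text \<open>The pattern behind most multilinearity proofs below: exhibit the expression as a fixed
  elementary tensor in which one slot depends linearly on the varied argument.\<close>

lemma pure_update_hom:
  assumes "module K W" "xs \<in> tuples W n" "i < n" "f \<in> module_hom K V W"
  shows "(\<lambda>x. pure K W (xs[i := f x])) \<in> module_hom K V (tensor_power K W n)"
  by (rule module_hom_comp[OF assms(4) pure_update[OF assms(1-3)]])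

text \<open>The definite description in \<open>tensor_lift\<close> is justified by
  \<open>tensor_lift_ex1\<close> only for multilinear data; hence each map below that is defined as
  a lift is preceded by a multilinearity lemma.\<close>

lemma tensor_lift_in_Hom:
  assumes "module K V" "module K W" "multilinear K V n W f"
  shows "tensor_lift K V n W f \<in> carrier (Hom K (tensor_power K V n) W)"
  unfolding tensor_lift_def using theI'[OF tensor_lift_ex1[OF assms]] by blast

lemma tensor_lift_pure:
  assumes "module K V" "module K W" "multilinear K V n W f" "xs \<in> tuples V n"
  shows "tensor_lift K V n W f (pure K V xs) = f xs"
  unfolding tensor_lift_def using theI'[OF tensor_lift_ex1[OF assms(1-3)]] assms(4) by blast

lemma tensor_Hom_eqI:
  assumes "module K V" "module K W"
    and "f \<in> carrier (Hom K (tensor_power K V n) W)" "g \<in> carrier (Hom K (tensor_power K V n) W)"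
    and "\<And>xs. xs \<in> tuples V n \<Longrightarrow> f (pure K V xs) = g (pure K V xs)"
  shows "f = g"
  by (rule Hom_eqI[OF assms(3,4)], rule tensor_hom_eqI[OF assms(1,2)])
    (use assms in \<open>auto simp: Hom_carrier\<close>)

lemma multilinearI:
  assumes "\<And>xs. xs \<in> tuples V n \<Longrightarrow> f xs \<in> carrier W"
    and "\<And>xs i. \<lbrakk>xs \<in> tuples V n; i < n\<rbrakk> \<Longrightarrow> (\<lambda>x. f (xs[i := x])) \<in> module_hom K V W"
  shows "multilinear K V n W f"
  using assms by (auto simp: multilinear_def)

text \<open>Elements of \<open>Hom K (tensor_power K V n) W\<close> are determined by their values on elementary
  tensors, so it suffices to test multilinearity there.\<close>

lemma multilinear_into_Hom:
  assumes U: "module K U" and V: "module K V" and W: "module K W"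
    and c: "\<And>us. us \<in> tuples U m \<Longrightarrow> F us \<in> carrier (Hom K (tensor_power K V n) W)"
    and ml: "\<And>xs. xs \<in> tuples V n \<Longrightarrow> multilinear K U m W (\<lambda>us. F us (pure K V xs))"
  shows "multilinear K U m (Hom K (tensor_power K V n) W) F"
proof (rule multilinearI[OF c])
  fix us i assume us: "us \<in> tuples U m" and i: "i < m"
  interpret U: module K U by fact
  note T = tensor_power_module[OF V, of n]
  interpret H: module K "Hom K (tensor_power K V n) W" by (rule Hom_module[OF T W])
  have lin: "(\<lambda>u. F (us[i := u]) (pure K V xs)) \<in> module_hom K U W" if "xs \<in> tuples V n" for xs
    using ml[OF that] us i by (auto simp: multilinear_def)
  note cu = c[OF tuples_update[OF us]]
  show "(\<lambda>u. F (us[i := u])) \<in> module_hom K U (Hom K (tensor_power K V n) W)"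
    by (rule module_homI; (rule tensor_Hom_eqI[OF V W, of _ n])?)
      (simp_all add: cu Hom_apply pure_closed[OF V] module_hom_add[OF lin] module_hom_smult[OF lin])
qed


section \<open>Maps between tensor powers\<close>

abbreviation app_list :: "('a \<Rightarrow> 'b) list \<Rightarrow> 'a list \<Rightarrow> 'b list"
  where "app_list fs xs \<equiv> map2 (\<lambda>f x. f x) fs xs"

lemma app_list_update_left:
  assumes "length fs = length xs" "i < length xs"
  shows "app_list (fs[i := f]) xs = (app_list fs xs)[i := f (xs ! i)]"
  by (rule nth_equalityI) (use assms in \<open>auto simp: nth_list_update\<close>)

lemma app_list_update_right:
  assumes "length fs = length xs" "i < length xs"
  shows "app_list fs (xs[i := x]) = (app_list fs xs)[i := (fs ! i) x]"
  by (rule nth_equalityI) (use assms in \<open>auto simp: nth_list_update\<close>)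

lemma app_list_tuples:
  assumes "fs \<in> tuples (Hom K V W) n" "xs \<in> tuples V n"
  shows "app_list fs xs \<in> tuples W n"
  using assms by (auto simp: tuples_def dest!: set_zip_leftD set_zip_rightD
      intro: Hom_in_carrier[of _ K V W] elim!: in_set_zipE)

context
  fixes K :: "('k, 'r) ring_scheme" and V :: "('k, 'a, 'x) module_scheme"
    and W :: "('k, 'b, 'y) module_scheme"
  assumes V: "module K V" and W: "module K W"
begin

text \<open>Varying argument \<open>i\<close> affects only slot \<open>i\<close> of the result,
  where the linear map \<open>fs ! i\<close> acts. This justifies the inner lift of
  \<open>hom_tensor\<close>.\<close>

lemma multilinear_pure_app_list:
  assumes fs: "fs \<in> tuples (Hom K V W) n"
  shows "multilinear K V n (tensor_power K W n) (\<lambda>xs. pure K W (app_list fs xs))"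
proof (rule multilinearI)
  fix xs assume xs: "xs \<in> tuples V n"
  show "pure K W (app_list fs xs) \<in> carrier (tensor_power K W n)"
    by (rule pure_closed[OF W app_list_tuples[OF fs xs]])
  fix i assume i: "i < n"
  show "(\<lambda>x. pure K W (app_list fs (xs[i := x]))) \<in> module_hom K V (tensor_power K W n)"
    using pure_update_hom[OF W app_list_tuples[OF fs xs] i Hom_module_hom[OF tuples_nth[OF fs i]]]
      fs xs i
    by (simp add: app_list_update_right tuples_length)
qed

text \<open>This justifies the outer lift of \<open>hom_tensor\<close>. After testing on elementary
  tensors, varying the \<open>i\<close>-th map changes slot \<open>i\<close> through evaluation at
  \<open>xs ! i\<close>, which is linear by \<open>Hom_eval\<close>.\<close>

lemma multilinear_hom_tensor:
  "multilinear K (Hom K V W) n (Hom K (tensor_power K V n) (tensor_power K W n))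
     (\<lambda>fs. tensor_lift K V n (tensor_power K W n) (\<lambda>xs. pure K W (app_list fs xs)))"
proof (rule multilinear_into_Hom[OF Hom_module[OF V W] V tensor_power_module[OF W]])
  note lift = tensor_lift_pure[OF V tensor_power_module[OF W] multilinear_pure_app_list]
  show "tensor_lift K V n (tensor_power K W n) (\<lambda>xs. pure K W (app_list fs xs))
      \<in> carrier (Hom K (tensor_power K V n) (tensor_power K W n))"
    if "fs \<in> tuples (Hom K V W) n" for fs
    by (rule tensor_lift_in_Hom[OF V tensor_power_module[OF W] multilinear_pure_app_list[OF that]])
  fix xs assume xs: "xs \<in> tuples V n"
  show "multilinear K (Hom K V W) n (tensor_power K W n)
     (\<lambda>fs. tensor_lift K V n (tensor_power K W n) (\<lambda>xs. pure K W (app_list fs xs)) (pure K V xs))"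
  proof (rule multilinearI)
    fix fs assume fs: "fs \<in> tuples (Hom K V W) n"
    show "tensor_lift K V n (tensor_power K W n) (\<lambda>xs. pure K W (app_list fs xs)) (pure K V xs)
        \<in> carrier (tensor_power K W n)"
      by (simp add: lift[OF fs xs] pure_closed[OF W app_list_tuples[OF fs xs]])
    fix i assume i: "i < n"
    have *: "(\<lambda>f. pure K W (app_list (fs[i := f]) xs)) \<in>
        module_hom K (Hom K V W) (tensor_power K W n)"
      using pure_update_hom[OF W app_list_tuples[OF fs xs] i Hom_eval[OF tuples_nth[OF xs i]]] fs xs i
      by (simp add: app_list_update_left tuples_length)
    interpret H: module K "Hom K V W" by (rule Hom_module[OF V W])
    show "(\<lambda>f. tensor_lift K V n (tensor_power K W n)
          (\<lambda>xs. pure K W (app_list (fs[i := f]) xs)) (pure K V xs)) \<in>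
        module_hom K (Hom K V W) (tensor_power K W n)"
      \<comment> \<open>The value of the inner lift is known only for \<open>f\<close> in the
        carrier, so the linearity laws are transferred from the fact marked \<open>*\<close> law by
        law instead of by rewriting the whole function.\<close>
      by (rule module_homI)
        (simp_all add: lift[OF tuples_update[OF fs] xs]
          module_hom_in_carrier[OF *] module_hom_add[OF *] module_hom_smult[OF *])
  qed
qed

lemma hom_tensor_in_Hom:
  "hom_tensor K V W n \<in>
     carrier (Hom K (tensor_power K (Hom K V W) n) (Hom K (tensor_power K V n) (tensor_power K W n)))"
  unfolding hom_tensor_def
  by (rule tensor_lift_in_Hom[OF Hom_module[OF V W]
        Hom_module[OF tensor_power_module[OF V] tensor_power_module[OF W]] multilinear_hom_tensor])

lemma hom_tensor_pure:
  assumes fs: "fs \<in> tuples (Hom K V W) n" and xs: "xs \<in> tuples V n"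
  shows "hom_tensor K V W n (pure K (Hom K V W) fs) (pure K V xs) = pure K W (app_list fs xs)"
proof -
  have "hom_tensor K V W n (pure K (Hom K V W) fs) =
      tensor_lift K V n (tensor_power K W n) (\<lambda>xs. pure K W (app_list fs xs))"
    unfolding hom_tensor_def
    by (rule tensor_lift_pure[OF Hom_module[OF V W]
        Hom_module[OF tensor_power_module[OF V] tensor_power_module[OF W]] multilinear_hom_tensor fs])
  thus ?thesis
    using tensor_lift_pure[OF V tensor_power_module[OF W] multilinear_pure_app_list[OF fs] xs] by simp
qed

lemma hom_tensor_pure_in_Hom:
  assumes "fs \<in> tuples (Hom K V W) n"
  shows "hom_tensor K V W n (pure K (Hom K V W) fs) \<in>
    carrier (Hom K (tensor_power K V n) (tensor_power K W n))"
  by (rule Hom_in_carrier[OF hom_tensor_in_Hom pure_closed[OF Hom_module[OF V W] assms]])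

end

section \<open>Applying \<mu> to a block of adjacent slots\<close>

context
  fixes K :: "('k, 'r) ring_scheme" and V :: "('k, 'a, 'x) module_scheme" and n :: nat
  assumes V: "module K V"
begin

lemma multilinear_id_mult_id:
  assumes \<mu>: "\<mu> \<in> module_hom K (tensor_power K V n) V"
  shows "multilinear K V (p + n + q) (tensor_power K V (p + 1 + q))
    (\<lambda>xs. pure K V (take p xs @ [\<mu> (pure K V (take n (drop p xs)))] @ drop (p + n) xs))"
    (is "multilinear K V ?m ?T ?f")
proof (rule multilinearI)
  fix xs assume xs: "xs \<in> tuples V ?m"
  have len: "length xs = ?m" using xs by (rule tuples_length)
  let ?mid = "take n (drop p xs)"
  let ?ys = "take p xs @ [\<mu> (pure K V ?mid)] @ drop (p + n) xs"
  have mid: "?mid \<in> tuples V n"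
    by (rule tuples_take[OF tuples_drop[OF xs, of p "n + q"]]) simp_all
  have ys: "?ys \<in> tuples V (p + 1 + q)"
    using tuples_append[OF tuples_take[OF xs, of p] tuples_append[OF
        tuples_singleton[OF module_hom_in_carrier[OF \<mu> pure_closed[OF V mid]]] tuples_drop[OF xs]]]
    by (simp add: add.assoc)
  show "?f xs \<in> carrier ?T" by (rule pure_closed[OF V ys])
  fix i assume i: "i < ?m"
  consider "i < p" | "p \<le> i" "i < p + n" | "p + n \<le> i" by linarith
  thus "(\<lambda>x. ?f (xs[i := x])) \<in> module_hom K V ?T"
  proof cases
    case 1
    have "take p (xs[i := x]) @ [\<mu> (pure K V (take n (drop p (xs[i := x]))))] @ drop (p + n) (xs[i := x])
        = ?ys[i := x]" for x
      using 1 len by (simp add: take_update_swap list_update_append)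
    thus ?thesis using pure_update[OF V ys, of i] 1 by simp
  next
    \<comment> \<open>The varied slot lies inside the block fed to \<mu>, at position
      \<open>i - p\<close>; the whole block ends up in slot \<open>p\<close>, which therefore
      depends on \<open>x\<close> through \<mu> composed with \<open>pure_update\<close>.\<close>
    case 2
    have "take p (xs[i := x]) @ [\<mu> (pure K V (take n (drop p (xs[i := x]))))] @ drop (p + n) (xs[i := x])
        = ?ys[p := \<mu> (pure K V (?mid[i - p := x]))]" for x
      using 2 len by (simp add: take_update_swap drop_update_swap list_update_append list_update_beyond)
    moreover have "(\<lambda>x. \<mu> (pure K V (?mid[i - p := x]))) \<in> module_hom K V V"
      by (rule module_hom_comp[OF pure_update[OF V mid] \<mu>]) (use 2 in linarith)
    ultimately show ?thesis using pure_update_hom[OF V ys, of p] by simp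
  next
    case 3
    \<comment> \<open>To the right of the block, positions drop by \<open>n - 1\<close>: slot
      \<open>p + n + k\<close> becomes slot \<open>p + 1 + k\<close>.\<close>
    then obtain k where k: "i = p + n + k" using le_Suc_ex by blast
    have "take p (xs[i := x]) @ [\<mu> (pure K V (take n (drop p (xs[i := x]))))] @ drop (p + n) (xs[i := x])
        = ?ys[p + 1 + k := x]" for x
      using k len by (simp add: take_update_swap drop_update_swap list_update_append list_update_beyond)
    thus ?thesis using pure_update[OF V ys, of "p + 1 + k"] k i by simp
  qed
qed

lemma id_mult_id_in_Hom:
  assumes "\<mu> \<in> module_hom K (tensor_power K V n) V"
  shows "id_mult_id K V n \<mu> p q \<in>
    carrier (Hom K (tensor_power K V (p + n + q)) (tensor_power K V (p + 1 + q)))"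
  unfolding id_mult_id_def
  by (rule tensor_lift_in_Hom[OF V tensor_power_module[OF V] multilinear_id_mult_id[OF assms]])

lemma compose_id_mult_id_in_Hom:
  assumes \<mu>: "\<mu> \<in> module_hom K (tensor_power K V n) V" and p: "p \<in> {0..<n}"
  shows "compose (carrier (tensor_power K V (2 * n - 1))) \<mu> (id_mult_id K V n \<mu> p (n - 1 - p))
    \<in> carrier (Hom K (tensor_power K V (2 * n - 1)) V)"
proof -
  \<comment> \<open>The bound on \<open>p\<close> matters here: it prevents the natural subtraction
    \<open>n - 1 - p\<close> from truncating.\<close>
  have "p + n + (n - 1 - p) = 2 * n - 1" "p + 1 + (n - 1 - p) = n" using p by auto
  thus ?thesis
    using Hom_module_hom[OF id_mult_id_in_Hom[OF \<mu>, of p "n - 1 - p"]]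
    by (intro compose_Hom[OF tensor_power_module[OF V] _ \<mu>]) (simp only:)
qed

lemma id_mult_id_pure:
  assumes \<mu>: "\<mu> \<in> module_hom K (tensor_power K V n) V"
    and "xs \<in> tuples V p" "ys \<in> tuples V n" "zs \<in> tuples V q"
  shows "id_mult_id K V n \<mu> p q (pure K V (xs @ ys @ zs)) = pure K V (xs @ [\<mu> (pure K V ys)] @ zs)"
proof -
  have "xs @ ys @ zs \<in> tuples V (p + n + q)"
    using tuples_append[OF assms(2) tuples_append[OF assms(3,4)]] by (simp add: add.assoc)
  from tensor_lift_pure[OF V tensor_power_module[OF V] multilinear_id_mult_id[OF \<mu>] this]
  show ?thesis using assms(2-4)[THEN tuples_length] by (simp add: id_mult_id_def)
qed

section \<open>Applying \<Delta> to one slot\<close>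

lemma multilinear_pure_append:
  assumes xs: "xs \<in> tuples V p" and zs: "zs \<in> tuples V q"
  shows "multilinear K V n (tensor_power K V (p + n + q)) (\<lambda>ys. pure K V (xs @ ys @ zs))"
proof (rule multilinearI)
  fix ys assume ys: "ys \<in> tuples V n"
  have app: "xs @ ys @ zs \<in> tuples V (p + n + q)"
    using tuples_append[OF xs tuples_append[OF ys zs]] by (simp add: add.assoc)
  show "pure K V (xs @ ys @ zs) \<in> carrier (tensor_power K V (p + n + q))"
    by (rule pure_closed[OF V app])
  fix i assume i: "i < n"
  show "(\<lambda>x. pure K V (xs @ ys[i := x] @ zs)) \<in> module_hom K V (tensor_power K V (p + n + q))"
    using pure_update[OF V app, of "p + i"] i xs ys by (simp add: list_update_append tuples_length)
qed

lemma tensor_insert_in_Hom: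
  assumes "xs \<in> tuples V p" "zs \<in> tuples V q"
  shows "tensor_insert K V xs n zs \<in>
    carrier (Hom K (tensor_power K V n) (tensor_power K V (p + n + q)))"
  using tensor_lift_in_Hom[OF V tensor_power_module[OF V] multilinear_pure_append[OF assms]] assms
  by (simp add: tensor_insert_def tuples_length)

lemma tensor_insert_pure:
  assumes "xs \<in> tuples V p" "zs \<in> tuples V q" "ys \<in> tuples V n"
  shows "tensor_insert K V xs n zs (pure K V ys) = pure K V (xs @ ys @ zs)"
  using tensor_lift_pure[OF V tensor_power_module[OF V] multilinear_pure_append[OF assms(1,2)] assms(3)]
    assms
  by (simp add: tensor_insert_def tuples_length)

text \<open>In \<open>id_comult_id\<close> the inserted tensor is a value of \<Delta>, in general
  not elementary, so multilinearity in the surrounding entries is needed for the insertion map as an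
  element of \<open>Hom\<close>. By \<open>multilinear_into_Hom\<close> it is enough to insert
  elementary tensors. Both flanks are joined into one tuple \<open>ws\<close>.\<close>

lemma multilinear_tensor_insert:
  "multilinear K V (p + q) (Hom K (tensor_power K V n) (tensor_power K V (p + n + q)))
     (\<lambda>ws. tensor_insert K V (take p ws) n (drop p ws))"
proof (rule multilinear_into_Hom[OF V V tensor_power_module[OF V]])
  have spl: "take p ws \<in> tuples V p" "drop p ws \<in> tuples V q" if "ws \<in> tuples V (p + q)" for ws
    using that by (auto intro: tuples_take tuples_drop)
  show "tensor_insert K V (take p ws) n (drop p ws)
      \<in> carrier (Hom K (tensor_power K V n) (tensor_power K V (p + n + q)))"
    if "ws \<in> tuples V (p + q)" for ws
    by (rule tensor_insert_in_Hom[OF spl[OF that]])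
  fix ys assume ys: "ys \<in> tuples V n"
  note ins = tensor_insert_pure[OF spl ys]
  show "multilinear K V (p + q) (tensor_power K V (p + n + q))
     (\<lambda>ws. tensor_insert K V (take p ws) n (drop p ws) (pure K V ys))"
  proof (rule multilinearI)
    fix ws assume ws: "ws \<in> tuples V (p + q)"
    have app: "take p ws @ ys @ drop p ws \<in> tuples V (p + n + q)"
      using tuples_append[OF spl(1)[OF ws] tuples_append[OF ys spl(2)[OF ws]]] by (simp add: add.assoc)
    show "tensor_insert K V (take p ws) n (drop p ws) (pure K V ys) \<in> carrier (tensor_power K V (p + n + q))"
      using ins[OF ws ws] pure_closed[OF V app] by simp
    fix i assume i: "i < p + q"
    \<comment> \<open>Position of entry \<open>i\<close> of \<open>ws\<close> after
      \<open>ys\<close> has been inserted at \<open>p\<close>: entries of the right flank move by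
      \<open>n\<close>.\<close>
    define j where "j = (if i < p then i else n + i)"
    have "take p (ws[i := x]) @ ys @ drop p (ws[i := x]) = (take p ws @ ys @ drop p ws)[j := x]" for x
      using ws ys i
      by (auto simp: j_def tuples_length take_update_swap drop_update_swap list_update_append list_update_beyond)
    moreover have "(\<lambda>x. pure K V ((take p ws @ ys @ drop p ws)[j := x])) \<in>
        module_hom K V (tensor_power K V (p + n + q))"
      by (rule pure_update[OF V app]) (use i in \<open>auto simp: j_def\<close>)
    ultimately have *: "(\<lambda>x. pure K V (take p (ws[i := x]) @ ys @ drop p (ws[i := x]))) \<in>
        module_hom K V (tensor_power K V (p + n + q))" by simp
    interpret V: module K V by (rule V)
    have ins': "tensor_insert K V (take p (ws[i := x])) n (drop p (ws[i := x])) (pure K V ys) =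
        pure K V (take p (ws[i := x]) @ ys @ drop p (ws[i := x]))" if "x \<in> carrier V" for x
      using ins tuples_update[OF ws that] by blast
    show "(\<lambda>x. tensor_insert K V (take p (ws[i := x])) n (drop p (ws[i := x])) (pure K V ys)) \<in>
        module_hom K V (tensor_power K V (p + n + q))"
      by (rule module_homI)
        (simp_all add: ins' module_hom_in_carrier[OF *] module_hom_add[OF *] module_hom_smult[OF *])
  qed
qed

text \<open>Varying slot \<open>p\<close> composes \<Delta> with a fixed insertion map; varying any
  other slot keeps the inserted tensor fixed and falls under
  \<open>multilinear_tensor_insert\<close>.\<close>

lemma multilinear_id_comult_id:
  assumes \<Delta>: "\<Delta> \<in> module_hom K V (tensor_power K V n)"
  shows "multilinear K V (p + 1 + q) (tensor_power K V (p + n + q))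
    (\<lambda>xs. tensor_insert K V (take p xs) n (drop (p + 1) xs) (\<Delta> (xs ! p)))"
    (is "multilinear K V ?m ?T ?f")
proof (rule multilinearI)
  fix xs assume xs: "xs \<in> tuples V ?m"
  have len: "length xs = ?m" using xs by (rule tuples_length)
  have spl: "take p xs \<in> tuples V p" "drop (p + 1) xs \<in> tuples V q"
    using xs by (auto intro: tuples_take tuples_drop)
  let ?ws = "take p xs @ drop (p + 1) xs"
  have ws: "?ws \<in> tuples V (p + q)" by (rule tuples_append[OF spl])
  have c: "\<Delta> (xs ! p) \<in> carrier (tensor_power K V n)"
    by (rule module_hom_in_carrier[OF \<Delta> tuples_nth[OF xs]]) simp
  show "?f xs \<in> carrier ?T" by (rule Hom_in_carrier[OF tensor_insert_in_Hom[OF spl] c])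
  fix i assume i: "i < ?m"
  let ?lin = "(\<lambda>x. ?f (xs[i := x])) \<in> module_hom K V ?T"
  \<comment> \<open>Common treatment of the slots on both sides of \<open>p\<close>: here
    \<open>j\<close> is the position of slot \<open>i\<close> once slot \<open>p\<close> is deleted,
    namely \<open>i\<close> on the left and \<open>i - 1\<close> on the right.\<close>
  have ne: ?lin if "j < p + q"
      "\<And>x. take p (xs[i := x]) = take p (?ws[j := x])" "\<And>x. drop (p + 1) (xs[i := x]) = drop p (?ws[j := x])"
      "i \<noteq> p" for j
  proof -
    have "(\<lambda>x. tensor_insert K V (take p (?ws[j := x])) n (drop p (?ws[j := x]))) \<in>
        module_hom K V (Hom K (tensor_power K V n) ?T)"
      using multilinear_tensor_insert[of p q] ws \<open>j < p + q\<close> unfolding multilinear_def by blast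
    from module_hom_comp[OF this Hom_eval[OF c]] show ?thesis
      by (simp only: that(2,3) nth_list_update_neq[OF \<open>i \<noteq> p\<close>])
  qed
  consider "i < p" | "i = p" | "p < i" by linarith
  thus ?lin
  proof cases
    case 1
    show ?thesis
      by (rule ne[of i]) (use 1 len in \<open>auto simp: take_update_swap drop_update_swap list_update_append\<close>)
  next
    case 2
    show ?thesis
      using module_hom_comp[OF \<Delta> Hom_module_hom[OF tensor_insert_in_Hom[OF spl]]] 2 len by simp
  next
    case 3
    show ?thesis
      by (rule ne[of "i - 1"]) (use 3 i len in \<open>auto simp: take_update_swap
            drop_update_swap list_update_append list_update_beyond\<close>)
  qed
qed

lemma id_comult_id_in_Hom:
  assumes "\<Delta> \<in> module_hom K V (tensor_power K V n)"
  shows "id_comult_id K V n \<Delta> p q \<in>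
    carrier (Hom K (tensor_power K V (p + 1 + q)) (tensor_power K V (p + n + q)))"
  unfolding id_comult_id_def
  by (rule tensor_lift_in_Hom[OF V tensor_power_module[OF V] multilinear_id_comult_id[OF assms]])

lemma id_comult_id_pure:
  assumes \<Delta>: "\<Delta> \<in> module_hom K V (tensor_power K V n)"
    and "xs \<in> tuples V p" "y \<in> carrier V" "zs \<in> tuples V q"
  shows "id_comult_id K V n \<Delta> p q (pure K V (xs @ [y] @ zs)) = tensor_insert K V xs n zs (\<Delta> y)"
proof -
  have "xs @ [y] @ zs \<in> tuples V (p + 1 + q)"
    using tuples_append[OF assms(2) tuples_append[OF tuples_singleton[OF assms(3)] assms(4)]]
    by (simp add: add.assoc)
  from tensor_lift_pure[OF V tensor_power_module[OF V] multilinear_id_comult_id[OF \<Delta>] this]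
  show ?thesis using assms(2,4)[THEN tuples_length] by (simp add: id_comult_id_def nth_append)
qed

end


section \<open>The convolution product\<close>

context
  fixes K :: "('k, 'r) ring_scheme" and M :: "('k, 'm, 'y) module_scheme"
    and A :: "('k, 'a, 'x) module_scheme" and n :: nat
    and \<mu> :: "('a list \<Rightarrow> 'k) set \<Rightarrow> 'a" and \<Delta> :: "'m \<Rightarrow> ('m list \<Rightarrow> 'k) set"
  assumes M: "module K M" and A: "module K A"
    and \<mu>: "\<mu> \<in> module_hom K (tensor_power K A n) A"
    and \<Delta>: "\<Delta> \<in> module_hom K M (tensor_power K M n)"
begin

lemma convolution_apply:
  assumes "t \<in> carrier (tensor_power K (Hom K M A) n)" "v \<in> carrier M"
  shows "convolution K M A n \<Delta> \<mu> t v = \<mu> (hom_tensor K M A n t (\<Delta> v))"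
  using assms by (simp add: convolution_def compose_def)

text \<open>For fixed \<open>v\<close>, the value at \<open>v\<close> arises from the tensor
  \<open>t\<close> by three linear maps in turn: \<open>hom_tensor\<close>, evaluation at the tensor
  \<Delta> \<open>v\<close>, and \<mu>. \<open>module_hom_into_Hom\<close> then gives linearity in
  \<open>t\<close>.\<close>

lemma convolution_in_Hom:
  "convolution K M A n \<Delta> \<mu> \<in> carrier (Hom K (tensor_power K (Hom K M A) n) (Hom K M A))"
proof -
  let ?T = "tensor_power K (Hom K M A) n"
  let ?F = "\<lambda>t. compose (carrier M) \<mu> (compose (carrier M) (hom_tensor K M A n t) \<Delta>)"
  have T: "module K ?T" by (rule tensor_power_module[OF Hom_module[OF M A]])
  note L = hom_tensor_in_Hom[OF M A, of n]
  have "?F \<in> module_hom K ?T (Hom K M A)"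
  proof (rule module_hom_into_Hom[OF M A _ T])
    show "?F t \<in> carrier (Hom K M A)" if "t \<in> carrier ?T" for t
      by (rule compose_Hom[OF M Hom_module_hom[OF compose_Hom[OF M \<Delta>]] \<mu>])
        (rule Hom_module_hom[OF Hom_in_carrier[OF L that]])
    fix v assume v: "v \<in> carrier M"
    show "(\<lambda>t. ?F t v) \<in> module_hom K ?T A"
      using module_hom_comp[OF module_hom_comp[OF Hom_module_hom[OF L]
            Hom_eval[OF module_hom_in_carrier[OF \<Delta> v]]] \<mu>] v
      by (simp add: compose_def)
  qed
  from restrict_Hom[OF T this] show ?thesis by (simp add: convolution_def)
qed

text \<open>Two reductions to elementary tensors are needed. The first replaces \<open>t\<close> by
  an elementary tensor with entry \<open>y\<close> in slot \<open>p\<close>; \<Delta>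
  \<open>y\<close> need not be elementary, so the second, in \<open>insert\<close>, treats an
  arbitrary tensor \<open>u\<close> in its place.\<close>

lemma hom_tensor_convolution:
  assumes fs: "fs \<in> tuples (Hom K M A) p" and gs: "gs \<in> tuples (Hom K M A) n"
    and hs: "hs \<in> tuples (Hom K M A) q" and t: "t \<in> carrier (tensor_power K M (p + 1 + q))"
  shows "hom_tensor K M A (p + 1 + q)
      (pure K (Hom K M A) (fs @ [convolution K M A n \<Delta> \<mu> (pure K (Hom K M A) gs)] @ hs)) t =
    id_mult_id K A n \<mu> p q (hom_tensor K M A (p + n + q) (pure K (Hom K M A) (fs @ gs @ hs))
      (id_comult_id K M n \<Delta> p q t))"
proof -
  let ?H = "Hom K M A"
  let ?g = "convolution K M A n \<Delta> \<mu> (pure K ?H gs)"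
  let ?Lg = "hom_tensor K M A n (pure K ?H gs)"
  let ?L = "hom_tensor K M A (p + n + q) (pure K ?H (fs @ gs @ hs))"
  let ?\<mu> = "id_mult_id K A n \<mu> p q" and ?\<Delta> = "id_comult_id K M n \<Delta> p q"
  note TA = tensor_power_module[OF A] and TM = tensor_power_module[OF M]
  note H = Hom_module[OF M A]
  have pgs: "pure K ?H gs \<in> carrier (tensor_power K ?H n)" by (rule pure_closed[OF H gs])
  have g: "?g \<in> carrier ?H" by (rule Hom_in_carrier[OF convolution_in_Hom pgs])
  have fgh: "fs @ gs @ hs \<in> tuples ?H (p + n + q)"
    using tuples_append[OF fs tuples_append[OF gs hs]] by (simp add: add.assoc)
  have fgh1: "fs @ [?g] @ hs \<in> tuples ?H (p + 1 + q)"
    using tuples_append[OF fs tuples_append[OF tuples_singleton[OF g] hs]] by (simp add: add.assoc)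
  note Lg = Hom_module_hom[OF hom_tensor_pure_in_Hom[OF M A gs]]
  note L = Hom_module_hom[OF hom_tensor_pure_in_Hom[OF M A fgh]]
  note \<mu>' = Hom_module_hom[OF id_mult_id_in_Hom[OF A \<mu>, of p q]]
  note \<Delta>' = Hom_module_hom[OF id_comult_id_in_Hom[OF M \<Delta>, of p q]]
  have insert: "?\<mu> (?L (tensor_insert K M xs n zs u)) =
      pure K A (app_list fs xs @ [\<mu> (?Lg u)] @ app_list hs zs)"
    if xs: "xs \<in> tuples M p" and zs: "zs \<in> tuples M q" and u: "u \<in> carrier (tensor_power K M n)"
    for xs zs u
  proof -
    note fx = app_list_tuples[OF fs xs] and hz = app_list_tuples[OF hs zs]
    interpret A: module K A by (rule A)
    \<comment> \<open>The zero is a placeholder for slot \<open>p\<close>: overwriting it brings the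
      right-hand side into the form required by \<open>pure_update_hom\<close>, whence its linearity
      in \<open>u\<close>.\<close>
    let ?as = "app_list fs xs @ [\<zero>\<^bsub>A\<^esub>] @ app_list hs zs"
    have as: "?as \<in> tuples A (p + 1 + q)"
      using tuples_append[OF fx tuples_append[OF tuples_singleton hz]] by (simp add: add.assoc)
    have upd: "?as[p := a] = app_list fs xs @ [a] @ app_list hs zs" for a
      using tuples_length[OF fx] by (simp add: list_update_append)
    have 1: "(\<lambda>u. ?\<mu> (?L (tensor_insert K M xs n zs u))) \<in>
        module_hom K (tensor_power K M n) (tensor_power K A (p + 1 + q))"
      by (rule module_hom_comp[OF module_hom_comp[OF
            Hom_module_hom[OF tensor_insert_in_Hom[OF M xs zs]] L] \<mu>'])
    have 2: "(\<lambda>u. pure K A (app_list fs xs @ [\<mu> (?Lg u)] @ app_list hs zs)) \<in>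
        module_hom K (tensor_power K M n) (tensor_power K A (p + 1 + q))"
      using pure_update_hom[OF A as _ module_hom_comp[OF Lg \<mu>], of p] by (simp only: upd)
    show ?thesis
    proof (rule tensor_hom_eqI[OF M TA 1 2 _ u])
      fix ys assume ys: "ys \<in> tuples M n"
      note gy = app_list_tuples[OF gs ys]
      have xyz: "xs @ ys @ zs \<in> tuples M (p + n + q)"
        using tuples_append[OF xs tuples_append[OF ys zs]] by (simp add: add.assoc)
      have "app_list (fs @ gs @ hs) (xs @ ys @ zs) = app_list fs xs @ app_list gs ys @ app_list hs zs"
        using fs gs xs ys by (simp add: tuples_length)
      thus "?\<mu> (?L (tensor_insert K M xs n zs (pure K M ys))) =
          pure K A (app_list fs xs @ [\<mu> (?Lg (pure K M ys))] @ app_list hs zs)"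
        using id_mult_id_pure[OF A \<mu> fx gy hz]
        by (simp add: tensor_insert_pure[OF M xs zs ys] hom_tensor_pure[OF M A fgh xyz]
            hom_tensor_pure[OF M A gs ys])
    qed
  qed
  show ?thesis
  proof (rule tensor_hom_eqI[OF M TA _ _ _ t])
    show "hom_tensor K M A (p + 1 + q) (pure K ?H (fs @ [?g] @ hs)) \<in>
        module_hom K (tensor_power K M (p + 1 + q)) (tensor_power K A (p + 1 + q))"
      by (rule Hom_module_hom[OF hom_tensor_pure_in_Hom[OF M A fgh1]])
    show "(\<lambda>t. ?\<mu> (?L (?\<Delta> t))) \<in>
        module_hom K (tensor_power K M (p + 1 + q)) (tensor_power K A (p + 1 + q))"
      by (rule module_hom_comp[OF module_hom_comp[OF \<Delta>' L] \<mu>'])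
    fix ws assume ws: "ws \<in> tuples M (p + 1 + q)"
    \<comment> \<open>Slot \<open>p\<close> is the entry that \<Delta> expands on one side and that
      the convolution \<open>?g\<close> receives on the other.\<close>
    define xs y zs where "xs = take p ws" and "y = ws ! p" and "zs = drop (p + 1) ws"
    have ws_eq: "ws = xs @ [y] @ zs"
      using tuples_length[OF ws] id_take_nth_drop[of p ws] by (simp add: xs_def y_def zs_def)
    have xs: "xs \<in> tuples M p" and zs: "zs \<in> tuples M q" and y: "y \<in> carrier M"
      using ws by (auto simp: xs_def y_def zs_def intro: tuples_take tuples_drop tuples_nth)
    have app: "app_list (fs @ [?g] @ hs) ws = app_list fs xs @ [?g y] @ app_list hs zs"
      using fs xs by (simp add: ws_eq tuples_length)
    have comult: "?\<Delta> (pure K M ws) = tensor_insert K M xs n zs (\<Delta> y)"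
      unfolding ws_eq by (rule id_comult_id_pure[OF M \<Delta> xs y zs])
    show "hom_tensor K M A (p + 1 + q) (pure K ?H (fs @ [?g] @ hs)) (pure K M ws) =
        ?\<mu> (?L (?\<Delta> (pure K M ws)))"
      by (simp only: hom_tensor_pure[OF M A fgh1 ws] app comult convolution_apply[OF pgs y]
          insert[OF xs zs module_hom_in_carrier[OF \<Delta> y]])
  qed
qed

end

section \<open>Partial associativity of the convolution product\<close>

theorem proposition7:
  fixes K :: "('k, 'r) ring_scheme"
    and A :: "('k, 'a, 'x) module_scheme"
    and M :: "('k, 'm, 'y) module_scheme"
    and n :: nat
    and \<mu> :: "('a list \<Rightarrow> 'k) set \<Rightarrow> 'a"
    and \<Delta> :: "'m \<Rightarrow> ('m list \<Rightarrow> 'k) set"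
  assumes "field K"
    and "\<And>m :: nat. m > 0 \<Longrightarrow> [m] \<cdot>\<^bsub>K\<^esub> \<one>\<^bsub>K\<^esub> \<noteq> \<zero>\<^bsub>K\<^esub>"
    and "n \<ge> 2"
    and "partially_associative_algebra K A n \<mu>"
    and "totally_coassociative_coalgebra K M n \<Delta>"
  shows "partially_associative_algebra K (Hom K M A) n (convolution K M A n \<Delta> \<mu>)"
proof -
  interpret A: partially_associative_algebra K A n \<mu> by fact
  interpret M: totally_coassociative_coalgebra K M n \<Delta> by fact
  note A = A.module_axioms and M = M.module_axioms
  note \<mu> = Hom_module_hom[OF A.mult_linear] and \<Delta> = Hom_module_hom[OF M.comult_linear]
  let ?H = "Hom K M A" and ?c = "convolution K M A n \<Delta> \<mu>" and ?N = "2 * n - 1"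
  note H = Hom_module[OF M A]
  interpret H: module K ?H by (rule H)
  note TH = tensor_power_module[OF H] and TA = tensor_power_module[OF A]
  note c = convolution_in_Hom[OF M A \<mu> \<Delta>]
  let ?s = "\<lambda>p. (\<ominus>\<^bsub>K\<^esub> \<one>\<^bsub>K\<^esub>) [^]\<^bsub>K\<^esub> (p * (n - 1))"
  have s: "?s p \<in> carrier K" for p by simp
  have N: "p + n + (n - 1 - p) = ?N" "p + 1 + (n - 1 - p) = n" if "p \<in> {0..<n}" for p
    using that by auto
  note compA = compose_id_mult_id_in_Hom[OF A \<mu>]
    and compH = compose_id_mult_id_in_Hom[OF H Hom_module_hom[OF c]]
  let ?A = "\<lambda>p. compose (carrier (tensor_power K A ?N)) \<mu> (id_mult_id K A n \<mu> p (n - 1 - p))"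
  let ?C = "\<lambda>p. compose (carrier (tensor_power K ?H ?N)) ?c (id_mult_id K ?H n ?c p (n - 1 - p))"
  show ?thesis
  proof (intro partially_associative_algebra.intro vectorspace.intro
      partially_associative_algebra_axioms.intro H A.field_axioms c)
    let ?T = "tensor_power K ?H ?N"
    let ?sum = "\<Oplus>\<^bsub>Hom K ?T ?H\<^esub> p\<in>{0..<n}. ?s p \<odot>\<^bsub>Hom K ?T ?H\<^esub> ?C p"
    interpret HT: module K "Hom K ?T ?H" by (rule Hom_module[OF TH H])
    show "?sum = \<zero>\<^bsub>Hom K ?T ?H\<^esub>"
    proof (rule tensor_Hom_eqI[OF H H])
      show "?sum \<in> carrier (Hom K ?T ?H)"
        by (rule HT.finsum_closed, rule Pi_I, rule HT.smult_closed[OF s compH])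
      fix fs assume fs: "fs \<in> tuples ?H ?N"
      have pfs: "pure K ?H fs \<in> carrier ?T" by (rule pure_closed[OF H fs])
      have sum_H: "?sum (pure K ?H fs) = (\<Oplus>\<^bsub>?H\<^esub> p\<in>{0..<n}. ?s p \<odot>\<^bsub>?H\<^esub> ?C p (pure K ?H fs))"
        by (rule Hom_lincomb_apply[OF TH H finite_atLeastLessThan compH s pfs])
      have cH: "?C p (pure K ?H fs) \<in> carrier ?H" if "p \<in> {0..<n}" for p
        by (rule Hom_in_carrier[OF compH[OF that] pfs])
      show "?sum (pure K ?H fs) = \<zero>\<^bsub>Hom K ?T ?H\<^esub> (pure K ?H fs)"
        unfolding sum_H Hom_apply(3)[OF pfs]
      proof (rule Hom_eqI[of _ K M A])
        show "(\<Oplus>\<^bsub>?H\<^esub> p\<in>{0..<n}. ?s p \<odot>\<^bsub>?H\<^esub> ?C p (pure K ?H fs)) \<in> carrier ?H"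
          by (rule H.finsum_closed, rule Pi_I, rule H.smult_closed[OF s cH])
        fix v assume v: "v \<in> carrier M"
        note dv = module_hom_in_carrier[OF \<Delta> v]
        \<comment> \<open>Slot 0 is an arbitrary representative. Because \<open>w\<close>, and with
          it \<open>u\<close>, is common to all summands, the sum can later be read as one map
          evaluated at one tensor.\<close>
        define w where "w = id_comult_id K M n \<Delta> 0 (n - 1) (\<Delta> v)"
        define u where "u = hom_tensor K M A ?N (pure K ?H fs) w"
        have w: "id_comult_id K M n \<Delta> p (n - 1 - p) (\<Delta> v) = w" if "p \<in> {0..<n}" for p
          using fun_cong[OF M.total_coassoc[of p 0], of v] that v by (simp add: w_def compose_def)
        have "w \<in> carrier (tensor_power K M ?N)"
          using Hom_in_carrier[OF id_comult_id_in_Hom[OF M \<Delta>, of 0 "n - 1"], of "\<Delta> v"] dv \<open>n \<ge> 2\<close>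
          by (simp add: w_def mult_2)
        hence u: "u \<in> carrier (tensor_power K A ?N)"
          unfolding u_def by (rule Hom_in_carrier[OF hom_tensor_pure_in_Hom[OF M A fs]])
        have step: "?C p (pure K ?H fs) v = ?A p u" if p: "p \<in> {0..<n}" for p
        proof -
          define q where "q = n - 1 - p"
          have q: "p + n + q = ?N" "p + 1 + q = n" using N[OF p] by (simp_all add: q_def)
          \<comment> \<open>The middle block holds the \<open>n\<close> maps convolved first in the
            \<open>p\<close>-th summand.\<close>
          define f1 f2 f3 where "f1 = take p fs" and "f2 = take n (drop p fs)" and "f3 = drop (p + n) fs"
          have fs_eq: "fs = f1 @ f2 @ f3"
            by (simp add: f1_def f2_def f3_def add.commute flip: drop_drop)
          have f: "f1 \<in> tuples ?H p" "f2 \<in> tuples ?H n" "f3 \<in> tuples ?H q"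
            unfolding f1_def f2_def f3_def using q fs
            by (auto intro!: tuples_take tuples_drop[where k = "n + q"] tuples_drop[where k = q])
          have "?C p (pure K ?H fs) v = ?c (pure K ?H (f1 @ [?c (pure K ?H f2)] @ f3)) v"
            using id_mult_id_pure[OF H Hom_module_hom[OF c] f] pfs by (simp add: compose_def fs_eq q_def)
          also have "\<dots> = \<mu> (hom_tensor K M A n (pure K ?H (f1 @ [?c (pure K ?H f2)] @ f3)) (\<Delta> v))"
          proof (rule convolution_apply[OF M A \<mu> \<Delta> _ v])
            have "f1 @ [?c (pure K ?H f2)] @ f3 \<in> tuples ?H (p + (1 + q))"
              by (intro tuples_append tuples_singleton f Hom_in_carrier[OF c] pure_closed[OF H])
            thus "pure K ?H (f1 @ [?c (pure K ?H f2)] @ f3) \<in> carrier (tensor_power K ?H n)"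
              using q by (intro pure_closed[OF H]) (simp add: add.assoc)
          qed
          also have "\<dots> = \<mu> (id_mult_id K A n \<mu> p q (hom_tensor K M A ?N (pure K ?H fs)
              (id_comult_id K M n \<Delta> p q (\<Delta> v))))"
            \<comment> \<open>The identity applies with \<Delta> \<open>v\<close> as the tensor
              \<open>t\<close>, since \<open>p + 1 + q = n\<close>.\<close>
            using hom_tensor_convolution[OF M A \<mu> \<Delta> f, of "\<Delta> v"] dv by (simp only: q fs_eq)
          also have "\<dots> = ?A p u"
            using w[OF p] u by (simp add: q_def u_def compose_def)
          finally show ?thesis .
        qed
        have "(\<Oplus>\<^bsub>?H\<^esub> p\<in>{0..<n}. ?s p \<odot>\<^bsub>?H\<^esub> ?C p (pure K ?H fs)) v =
            (\<Oplus>\<^bsub>A\<^esub> p\<in>{0..<n}. ?s p \<odot>\<^bsub>A\<^esub> ?C p (pure K ?H fs) v)"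
          by (rule Hom_lincomb_apply[OF M A finite_atLeastLessThan cH s v])
        also have "\<dots> = (\<Oplus>\<^bsub>A\<^esub> p\<in>{0..<n}. ?s p \<odot>\<^bsub>A\<^esub> ?A p u)"
          by (rule A.finsum_cong'[OF refl], rule Pi_I, rule A.smult_closed[OF s Hom_in_carrier[OF compA u]])
              (simp_all only: step)
        \<comment> \<open>Collecting the values at \<open>u\<close> into a single element of
          \<open>Hom\<close> produces exactly the sum that \<open>A.partial_assoc\<close> declares
          to be zero.\<close>
        also have "\<dots> = (\<Oplus>\<^bsub>Hom K (tensor_power K A ?N) A\<^esub> p\<in>{0..<n}.
            ?s p \<odot>\<^bsub>Hom K (tensor_power K A ?N) A\<^esub> ?A p) u"
          by (rule Hom_lincomb_apply[OF TA A finite_atLeastLessThan compA s u, symmetric])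
        also have "\<dots> = \<zero>\<^bsub>?H\<^esub> v"
          by (simp only: A.partial_assoc Hom_apply(3)[OF u] Hom_apply(3)[OF v])
        finally show "(\<Oplus>\<^bsub>?H\<^esub> p\<in>{0..<n}. ?s p \<odot>\<^bsub>?H\<^esub> ?C p (pure K ?H fs)) v = \<zero>\<^bsub>?H\<^esub> v" .
      qed (rule H.zero_closed)
    qed (rule HT.zero_closed)
  qed
qed

end
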